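(* Let $l\ge1$, $\vec n=(n_l,\dots,n_0)$ with all $n_i\ge1$, $\gamma>0$, $1\le p<\infty$, $0<q\le\infty$, and let $\mathcal C^{l,\vec n}_{\gamma_{p,q}\le\gamma}=\{\vec C_l\in\mathcal C^{l,\vec n}:\gamma_{p,q}(\vec C_l)\le\gamma\}$. Then for every sample $S=(\vec x_1,\dots,\vec x_m)$: (1) if $1\le p\le2$, $R_S(\mathcal F\circ\mathcal C^{l,\vec n}_{\gamma_{p,q}\le\gamma})\le\gamma\,4^{n_l\max\{1/p^*,1/q\}}\prod_{i=1}^{l-1}4^{n_i/p^*}\frac{\sqrt{\min\{p^*,8n_0\}}}{\sqrt m}K_p(S,H)$; (2) if $2<p<\infty$, $R_S(\mathcal F\circ\mathcal C^{l,\vec n}_{\gamma_{p,q}\le\gamma})\le\gamma\,4^{n_l\max\{1/p^*,1/q\}}\prod_{i=1}^{l-1}4^{n_i/p^*}\frac{\sqrt{p^*}}{m^{1/p}}K_p(S,H)$.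
   Context: Pauli notation $P_{\vec z}$ as tensor products of $P_0=\mathbb I,P_1=X,P_2=Y,P_3=Z$. Representation matrix of a linear map $\Phi$ from $a$ to $b$ qubits: $M^\Phi_{\vec z\vec x}=2^{-b}\mathrm{Tr}(P_{\vec z}\Phi(P_{\vec x}))$. $p^*$ is the Hölder conjugate. $\mathcal C^{l,\vec n}$ is the set of depth-$l$ circuits $\vec C_l=(\Phi_l,\dots,\Phi_1)$, $\Phi_i$ a quantum channel from $n_{i-1}$ to $n_i$ qubits, implementing $C_l=\Phi_l\circ\cdots\circ\Phi_1$. Path norm: for $\vec z\in\{0,1,2,3\}^{n_l}$, $\gamma^{(\vec z)}_p(\vec C_l)=\big(\sum_{v_0,\dots,v_{l-1}}|M^{\Phi_l}_{\vec zv_{l-1}}M^{\Phi_{l-1}}_{v_{l-1}v_{l-2}}\cdots M^{\Phi_1}_{v_1v_0}|^p\big)^{1/p}$, the sum over $v_i\in\{0,1,2,3\}^{n_i}$; $\gamma_{p,q}(\vec C_l)=\big(4^{-n_l}\sum_{\vec z}\gamma_p^{(\vec z)}(\vec C_l)^q\big)^{1/q}$ (for $q=\infty$, $\max_{\vec z}\gamma^{(\vec z)}_p(\vec C_l)$). Setup: data encoded as $n_0$-qubit pure states $\rho(\vec x)$, $H$ Hermitian on $n_l$ qubits, $f_{\vec C_l}(\vec x)=\mathrm{Tr}(C_l(\rho(\vec x))H)$; $R_S(\mathcal G)=\mathbb E_{\vec\epsilon}\frac1m\sup_{g\in\mathcal G}|\sum_i\epsilon_ig(\vec x_i)|$ with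 i.i.d. uniform signs. $\vec\alpha\in\mathbb R^{4^{n_l}}$ has entries $\mathrm{Tr}(P_{\vec z}H)$, $\vec f_I(\vec x)\in\mathbb R^{4^{n_0}}$ has entries $2^{-n_0}\mathrm{Tr}(P_{\vec z}\rho(\vec x))$, $K_p(S,H)=\|\vec\alpha\|_p\max_i\|\vec f_I(\vec x_i)\|_{p^*}$. *)

theory Defs
  imports "Jordan_Normal_Form.Matrix" "HOL-Library.Extended_Real" Complex_Main
begin

definition mtrace :: "complex mat \<Rightarrow> complex" where
  "mtrace A = (\<Sum>i<dim_row A. A $$ (i, i))"

definition cadj :: "complex mat \<Rightarrow> complex mat" where
  "cadj A = mat (dim_col A) (dim_row A) (\<lambda>(i, j). cnj (A $$ (j, i)))"

definition hermitian_mat :: "nat \<Rightarrow> complex mat \<Rightarrow> bool" where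
  "hermitian_mat d A \<longleftrightarrow> A \<in> carrier_mat d d \<and> cadj A = A"

definition psd_mat :: "nat \<Rightarrow> complex mat \<Rightarrow> bool" where
  "psd_mat d A \<longleftrightarrow> A \<in> carrier_mat d d \<and>
     (\<forall>v :: complex vec. dim_vec v = d \<longrightarrow>
        (\<Sum>i<d. \<Sum>j<d. cnj (v $ i) * A $$ (i, j) * v $ j) \<in> \<real> \<and>
        Re (\<Sum>i<d. \<Sum>j<d. cnj (v $ i) * A $$ (i, j) * v $ j) \<ge> 0)"

definition kron :: "complex mat \<Rightarrow> complex mat \<Rightarrow> complex mat" where
  "kron A B = mat (dim_row A * dim_row B) (dim_col A * dim_col B)
     (\<lambda>(i, j). A $$ (i div dim_row B, j div dim_col B) * B $$ (i mod dim_row B, j mod dim_col B))"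

definition pauli1 :: "nat \<Rightarrow> complex mat" where
  "pauli1 k = (if k = 0 then mat_of_rows_list 2 [[1, 0], [0, 1]]
     else if k = 1 then mat_of_rows_list 2 [[0, 1], [1, 0]]
     else if k = 2 then mat_of_rows_list 2 [[0, -\<i>], [\<i>, 0]]
     else mat_of_rows_list 2 [[1, 0], [0, -1]])"

fun pauli :: "nat list \<Rightarrow> complex mat" where
  "pauli [] = 1\<^sub>m 1"
| "pauli (k # z) = kron (pauli1 k) (pauli z)"

definition pstrs :: "nat \<Rightarrow> nat list set" where
  "pstrs n = {z. length z = n \<and> set z \<subseteq> {0..<4}}"

text \<open>(id_k \<otimes> \<Phi>)(X) for X a (k 2^a) x (k 2^a) matrix, viewed as a k x k block matrix of
  2^a x 2^a blocks.\<close>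
definition ampl :: "nat \<Rightarrow> nat \<Rightarrow> nat \<Rightarrow> (complex mat \<Rightarrow> complex mat) \<Rightarrow> complex mat \<Rightarrow> complex mat" where
  "ampl a b k \<Phi> X = mat (k * 2^b) (k * 2^b) (\<lambda>(i, j).
     \<Phi> (mat (2^a) (2^a) (\<lambda>(u, v). X $$ ((i div 2^b) * 2^a + u, (j div 2^b) * 2^a + v)))
       $$ (i mod 2^b, j mod 2^b))"

definition qchannel :: "nat \<Rightarrow> nat \<Rightarrow> (complex mat \<Rightarrow> complex mat) \<Rightarrow> bool" where
  "qchannel a b \<Phi> \<longleftrightarrow>
     (\<forall>X \<in> carrier_mat (2^a) (2^a). \<Phi> X \<in> carrier_mat (2^b) (2^b)) \<and>
     (\<forall>X \<in> carrier_mat (2^a) (2^a). \<forall>Y \<in> carrier_mat (2^a) (2^a). \<forall>c :: complex.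
        \<Phi> (c \<cdot>\<^sub>m X + Y) = c \<cdot>\<^sub>m \<Phi> X + \<Phi> Y) \<and>
     (\<forall>X \<in> carrier_mat (2^a) (2^a). mtrace (\<Phi> X) = mtrace X) \<and>
     (\<forall>k X. psd_mat (k * 2^a) X \<longrightarrow> psd_mat (k * 2^b) (ampl a b k \<Phi> X))"

definition repM :: "nat \<Rightarrow> (complex mat \<Rightarrow> complex mat) \<Rightarrow> nat list \<Rightarrow> nat list \<Rightarrow> complex" where
  "repM b \<Phi> z x = mtrace (pauli z * \<Phi> (pauli x)) / 2 ^ b"

definition circuits :: "nat \<Rightarrow> (nat \<Rightarrow> nat) \<Rightarrow> (nat \<Rightarrow> complex mat \<Rightarrow> complex mat) set" where
  "circuits l n = {\<Phi>. \<forall>i\<in>{1..l}. qchannel (n (i - 1)) (n i) (\<Phi> i)}"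

fun circ_comp :: "(nat \<Rightarrow> complex mat \<Rightarrow> complex mat) \<Rightarrow> nat \<Rightarrow> complex mat \<Rightarrow> complex mat" where
  "circ_comp \<Phi> 0 = id"
| "circ_comp \<Phi> (Suc k) = \<Phi> (Suc k) \<circ> circ_comp \<Phi> k"

definition path_norm :: "real \<Rightarrow> nat \<Rightarrow> (nat \<Rightarrow> nat) \<Rightarrow> (nat \<Rightarrow> complex mat \<Rightarrow> complex mat) \<Rightarrow> nat list \<Rightarrow> real" where
  "path_norm p l n \<Phi> z =
     (\<Sum>v \<in> PiE {..<l} (\<lambda>i. pstrs (n i)).
        (\<Prod>i\<in>{1..l}. cmod (repM (n i) (\<Phi> i)
            (if i = l then z else v i) (v (i - 1)))) powr p) powr (1 / p)"

definition gamma_pq :: "real \<Rightarrow> ereal \<Rightarrow> nat \<Rightarrow> (nat \<Rightarrow> nat) \<Rightarrow> (nat \<Rightarrow> complex mat \<Rightarrow> complex mat) \<Rightarrow> real" where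
  "gamma_pq p q l n \<Phi> =
     (if q = \<infinity> then Max ((\<lambda>z. path_norm p l n \<Phi> z) ` pstrs (n l))
      else (((1 / 4 ^ n l) * (\<Sum>z \<in> pstrs (n l). path_norm p l n \<Phi> z powr real_of_ereal q))
            powr (1 / real_of_ereal q)))"

definition hconj :: "real \<Rightarrow> ereal" where
  "hconj p = (if p = 1 then \<infinity> else ereal (p / (p - 1)))"

definition einv :: "ereal \<Rightarrow> real" where
  "einv x = (if x = \<infinity> then 0 else 1 / real_of_ereal x)"

definition lpnorm :: "ereal \<Rightarrow> ('a \<Rightarrow> real) \<Rightarrow> 'a set \<Rightarrow> real" where
  "lpnorm p f A = (if p = \<infinity> then Max ((\<lambda>a. \<bar>f a\<bar>) ` A)
     else (\<Sum>a\<in>A. \<bar>f a\<bar> powr real_of_ereal p) powr (1 / real_of_ereal p))"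

definition pure_state :: "nat \<Rightarrow> complex mat \<Rightarrow> bool" where
  "pure_state n \<rho> \<longleftrightarrow> (\<exists>\<psi> :: complex vec. dim_vec \<psi> = 2^n \<and>
      (\<Sum>i<2^n. (cmod (\<psi> $ i))\<^sup>2) = 1 \<and>
      \<rho> = mat (2^n) (2^n) (\<lambda>(i, j). \<psi> $ i * cnj (\<psi> $ j)))"

text \<open>Empirical Rademacher complexity of a class of real functions on the sample xs (m = length xs):
  E_\<epsilon> (1/m) sup_g |\<Sum>_i \<epsilon>_i g(x_i)|, the sup taken in the extended reals (sup of the empty class is -\<infinity>).\<close>
definition rademacher :: "'x list \<Rightarrow> ('x \<Rightarrow> real) set \<Rightarrow> ereal" where
  "rademacher xs G =
     ereal (1 / (2 ^ length xs * real (length xs))) *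
     (\<Sum>\<epsilon> \<in> PiE {..<length xs} (\<lambda>_. {-1, 1 :: real}).
        (SUP g\<in>G. ereal \<bar>\<Sum>i<length xs. \<epsilon> i * g (xs ! i)\<bar>))"

text \<open>f_C(x) = Tr(C(\<rho>(x)) H) (a real number under the standing assumptions).\<close>
definition model_fun :: "nat \<Rightarrow> (nat \<Rightarrow> complex mat \<Rightarrow> complex mat) \<Rightarrow> ('x \<Rightarrow> complex mat) \<Rightarrow> complex mat \<Rightarrow> 'x \<Rightarrow> real" where
  "model_fun l \<Phi> \<rho> H x = Re (mtrace (circ_comp \<Phi> l (\<rho> x) * H))"

definition model_class :: "real \<Rightarrow> ereal \<Rightarrow> real \<Rightarrow> nat \<Rightarrow> (nat \<Rightarrow> nat) \<Rightarrow> ('x \<Rightarrow> complex mat) \<Rightarrow> complex mat \<Rightarrow> ('x \<Rightarrow> real) set" where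
  "model_class p q \<gamma> l n \<rho> H =
     (\<lambda>\<Phi>. model_fun l \<Phi> \<rho> H) ` {\<Phi> \<in> circuits l n. gamma_pq p q l n \<Phi> \<le> \<gamma>}"

definition Kp :: "real \<Rightarrow> nat \<Rightarrow> nat \<Rightarrow> ('x \<Rightarrow> complex mat) \<Rightarrow> 'x list \<Rightarrow> complex mat \<Rightarrow> real" where
  "Kp p n0 nl \<rho> xs H =
     lpnorm (ereal p) (\<lambda>z. cmod (mtrace (pauli z * H))) (pstrs nl) *
     Max ((\<lambda>i. lpnorm (hconj p) (\<lambda>z. cmod (mtrace (pauli z * \<rho> (xs ! i))) / 2 ^ n0) (pstrs n0))
           ` {..<length xs})"

end

theory Submission
  imports Defs "HOL-Probability.Hoeffding"
begin

text \<open>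
  In the Pauli basis the value of a circuit is \<open>\<Sum>z \<alpha> z * \<Sum>v M z v * f (v 0)\<close>, a sum over Pauli paths \<open>v\<close>.
  Hoelder's inequality over the paths ending in \<open>z\<close> splits off the path norm and leaves the \<open>p*\<close>-norm of
  \<open>F = \<Sum>i \<epsilon> i * f i\<close>, counted once for each choice of the intermediate Pauli strings. Hoelder's inequality
  over \<open>z\<close>, together with a comparison of the \<open>p*\<close>- and \<open>q\<close>-norms of the path norms, turns the sum over \<open>z\<close>
  into \<open>\<gamma>\<close> times the \<open>p\<close>-norm of \<open>\<alpha>\<close>. It remains to average the \<open>p*\<close>-norm of \<open>F\<close> over the signs. For
  \<open>p* \<ge> 2\<close> this is Khintchine's inequality applied coordinatewise with constant \<open>sqrt p*\<close>; when \<open>p* > 8 n0\<close>,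
  one first passes to the exponent \<open>4 n0\<close>. For \<open>p* \<le> 2\<close> the second moment suffices.
\<close>

section \<open>Finite lp norms\<close>

text \<open>Normalise both families to unit norm and sum Young's inequality over \<open>A\<close>;
  the right side then totals \<open>1 / p + 1 / q = 1\<close>. If one of the power sums vanishes
  there is nothing to normalise, but then every product is zero.\<close>

lemma sum_Holder:
  fixes f g :: "'a \<Rightarrow> real"
  assumes A: "finite A" and pq: "p > 1" "q > 1" "1 / p + 1 / q = 1"
    and f: "\<And>a. a \<in> A \<Longrightarrow> f a \<ge> 0" and g: "\<And>a. a \<in> A \<Longrightarrow> g a \<ge> 0"
  shows "(\<Sum>a\<in>A. f a * g a) \<le> (\<Sum>a\<in>A. f a powr p) powr (1 / p) * (\<Sum>a\<in>A. g a powr q) powr (1 / q)"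
proof -
  define F G where "F = (\<Sum>a\<in>A. f a powr p)" and "G = (\<Sum>a\<in>A. g a powr q)"
  have nn: "F \<ge> 0" "G \<ge> 0" by (auto simp: F_def G_def intro: sum_nonneg)
  show ?thesis
  proof (cases "F = 0 \<or> G = 0")
    case True
    have "f a * g a = 0" if "a \<in> A" for a
    proof -
      from True have "f a powr p = 0 \<or> g a powr q = 0"
        using that A by (auto simp: F_def G_def sum_nonneg_eq_0_iff)
      then show ?thesis by simp
    qed
    then have "(\<Sum>a\<in>A. f a * g a) = 0" by (rule sum.neutral[rule_format])
    then show ?thesis by simp
  next
    case False
    then have pos: "F > 0" "G > 0" using nn by auto
    define \<alpha> \<beta> where "\<alpha> = F powr (1 / p)" and "\<beta> = G powr (1 / q)"
    have ab: "\<alpha> > 0" "\<beta> > 0" using pos by (auto simp: \<alpha>_def \<beta>_def)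
    have ap: "\<alpha> powr p = F" "\<beta> powr q = G"
      using pos pq by (auto simp: \<alpha>_def \<beta>_def powr_powr)
    have "(\<Sum>a\<in>A. f a / \<alpha> * (g a / \<beta>)) \<le> (\<Sum>a\<in>A. (f a / \<alpha>) powr p / p + (g a / \<beta>) powr q / q)"
      using f g ab by (intro sum_mono Youngs_inequality pq) auto
    also have "\<dots> = (\<Sum>a\<in>A. f a powr p) / F / p + (\<Sum>a\<in>A. g a powr q) / G / q"
      using f g ab by (simp add: sum.distrib sum_divide_distrib powr_divide ap)
    also have "\<dots> = 1" using pos pq by (simp flip: F_def G_def)
    finally have "(\<Sum>a\<in>A. f a * g a) / (\<alpha> * \<beta>) \<le> 1" by (simp add: sum_divide_distrib)
    then show ?thesis using ab by (simp add: \<alpha>_def \<beta>_def F_def G_def field_simps)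
  qed
qed

text \<open>Hoelder against the constant \<open>1\<close>, raised to the power \<open>t\<close>: the
  conjugate exponent \<open>q = t / (t - 1)\<close> gives the cardinality the power
  \<open>t / q = t - 1\<close>. It serves as Jensen's inequality for averages over signs and over
  samples.\<close>

lemma power_mean_sum:
  fixes y :: "'a \<Rightarrow> real"
  assumes A: "finite A" and t: "t \<ge> 1" and y: "\<And>a. a \<in> A \<Longrightarrow> y a \<ge> 0"
  shows "(\<Sum>a\<in>A. y a) powr t \<le> real (card A) powr (t - 1) * (\<Sum>a\<in>A. y a powr t)"
proof (cases "t = 1 \<or> A = {}")
  case True
  then show ?thesis using y A by (auto simp: sum_nonneg card_gt_0_iff)
next
  case False
  then have t1: "t > 1" and ne: "card A > 0" using t A by (auto simp: card_gt_0_iff)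
  define q where "q = t / (t - 1)"
  have q: "q > 1" "1 / t + 1 / q = 1" using t1 by (auto simp: q_def field_simps)
  have "(\<Sum>a\<in>A. y a) \<le> (\<Sum>a\<in>A. y a powr t) powr (1 / t) * real (card A) powr (1 / q)"
    using sum_Holder[OF A t1 q y, where g = "\<lambda>_. 1"] by simp
  then have "(\<Sum>a\<in>A. y a) powr t \<le> ((\<Sum>a\<in>A. y a powr t) powr (1 / t) * real (card A) powr (1 / q)) powr t"
    using t1 y by (intro powr_mono2) (auto intro: sum_nonneg)
  also have "\<dots> = (\<Sum>a\<in>A. y a powr t) * real (card A) powr (t - 1)"
    using t1 by (simp add: powr_mult powr_powr sum_nonneg q_def)
  finally show ?thesis by (simp add: mult.commute)
qed

text \<open>Each \<open>y a\<close> is at most the total \<open>S\<close>, so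
  \<open>y a * y a powr (t - 1)\<close> is at most \<open>y a * S powr (t - 1)\<close>, and these
  sum to \<open>S powr t\<close>.\<close>

lemma sum_powr_le_powr_sum:
  fixes y :: "'a \<Rightarrow> real"
  assumes A: "finite A" and t: "t \<ge> 1" and y: "\<And>a. a \<in> A \<Longrightarrow> y a \<ge> 0"
  shows "(\<Sum>a\<in>A. y a powr t) \<le> (\<Sum>a\<in>A. y a) powr t"
proof -
  define S where "S = (\<Sum>a\<in>A. y a)"
  have S: "S \<ge> 0" using y by (auto simp: S_def intro: sum_nonneg)
  have eq: "x powr t = x * x powr (t - 1)" if "x \<ge> 0" for x :: real
    using that by (cases "x = 0") (auto simp: powr_mult_base)
  have "y a \<le> S" if "a \<in> A" for a
    using that y A by (auto simp: S_def intro: member_le_sum)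
  then have "(\<Sum>a\<in>A. y a powr t) \<le> (\<Sum>a\<in>A. y a * S powr (t - 1))"
    using y t S by (intro sum_mono) (auto simp: eq intro!: mult_left_mono powr_mono2)
  also have "\<dots> = S powr t" using S by (simp add: S_def eq flip: sum_distrib_right)
  finally show ?thesis by (simp add: S_def)
qed

section \<open>Comparison and duality of lp norms, the infinite exponent included\<close>

lemma lpnorm_nonneg: "finite A \<Longrightarrow> A \<noteq> {} \<Longrightarrow> lpnorm r f A \<ge> 0"
  by (auto simp: lpnorm_def Max_ge_iff)

lemma lpnorm_cong: "(\<And>a. a \<in> A \<Longrightarrow> \<bar>f a\<bar> = \<bar>g a\<bar>) \<Longrightarrow> lpnorm r f A = lpnorm r g A"
  using image_cong[of A A "\<lambda>a. \<bar>f a\<bar>" "\<lambda>a. \<bar>g a\<bar>"] by (simp add: lpnorm_def)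

lemma lpnorm_ereal: "lpnorm (ereal r) f A = (\<Sum>a\<in>A. \<bar>f a\<bar> powr r) powr (1 / r)"
  by (simp add: lpnorm_def)

lemma sum_powr_le_of_lpnorm_le:
  assumes r: "r > 0" and D: "lpnorm (ereal r) f A \<le> D"
  shows "(\<Sum>a\<in>A. \<bar>f a\<bar> powr r) \<le> D powr r"
proof -
  have "(\<Sum>a\<in>A. \<bar>f a\<bar> powr r) = lpnorm (ereal r) f A powr r"
    using r by (simp add: lpnorm_ereal powr_powr sum_nonneg)
  also have "\<dots> \<le> D powr r" using r D by (intro powr_mono2) (auto simp: lpnorm_ereal)
  finally show ?thesis .
qed

text \<open>The power of the cardinality is \<open>1 / r - 1 / q\<close> for \<open>r < q\<close>,
  the price of the power mean inequality, and \<open>0\<close> otherwise, since lp norms decrease in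
  the exponent. Holding both cases in one maximum produces the \<open>max\<close> of the final
  bound. Exponents below 1 are allowed.\<close>

lemma lpnorm_le_lpnorm:
  assumes A: "finite A" "A \<noteq> {}" and r: "0 < r" and q: "0 < q"
  shows "lpnorm r f A \<le> real (card A) powr (max (einv r) (einv q) - einv q) * lpnorm q f A"
proof -
  define N where "N = real (card A)"
  have N: "N > 0" using A by (simp add: N_def card_gt_0_iff)
  consider "r = \<infinity>" "q = \<infinity>" | s where "r = \<infinity>" "q = ereal s" "s > 0"
    | s where "q = \<infinity>" "r = ereal s" "s > 0"
    | s t where "r = ereal s" "q = ereal t" "s > 0" "t > 0"
    using r q by (cases r; cases q) auto
  then show ?thesis
  proof cases
    case 1
    then show ?thesis using N by (simp add: N_def)
  next
    case (2 s)
    have "\<bar>f a\<bar> \<le> (\<Sum>a\<in>A. \<bar>f a\<bar> powr s) powr (1 / s)" if "a \<in> A" for a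
    proof -
      have "\<bar>f a\<bar> = (\<bar>f a\<bar> powr s) powr (1 / s)" using 2 by (simp add: powr_powr)
      also have "\<dots> \<le> (\<Sum>a\<in>A. \<bar>f a\<bar> powr s) powr (1 / s)"
        using 2 that A by (intro powr_mono2 member_le_sum) auto
      finally show ?thesis .
    qed
    then show ?thesis using 2 N A by (auto simp: lpnorm_def einv_def N_def max_def)
  next
    case (3 s)
    define M where "M = Max ((\<lambda>a. \<bar>f a\<bar>) ` A)"
    have M: "\<bar>f a\<bar> \<le> M" if "a \<in> A" for a using that A by (auto simp: M_def)
    then have M0: "M \<ge> 0" using A by fastforce
    have "(\<Sum>a\<in>A. \<bar>f a\<bar> powr s) \<le> (\<Sum>a\<in>A. M powr s)"
      using M 3 by (intro sum_mono powr_mono2) auto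
    then have "(\<Sum>a\<in>A. \<bar>f a\<bar> powr s) powr (1 / s) \<le> (N * M powr s) powr (1 / s)"
      using 3 by (intro powr_mono2) (auto simp: N_def sum_nonneg)
    also have "\<dots> = N powr (1 / s) * M"
      using N M0 3 by (simp add: powr_mult powr_powr)
    finally show ?thesis using 3 by (simp add: lpnorm_def einv_def M_def N_def max_def)
  next
    case (4 s t)
    show ?thesis
    proof (cases "t \<le> s")
      case True
      have "(\<Sum>a\<in>A. (\<bar>f a\<bar> powr t) powr (s / t)) \<le> (\<Sum>a\<in>A. \<bar>f a\<bar> powr t) powr (s / t)"
        using 4 True A by (intro sum_powr_le_powr_sum) auto
      then have "(\<Sum>a\<in>A. \<bar>f a\<bar> powr s) powr (1 / s) \<le> ((\<Sum>a\<in>A. \<bar>f a\<bar> powr t) powr (s / t)) powr (1 / s)"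
        using 4 by (intro powr_mono2) (auto simp: powr_powr intro: sum_nonneg)
      moreover have "max (1 / s) (1 / t) = 1 / t" using 4 True by (simp add: max_def frac_le)
      ultimately show ?thesis using 4 N by (simp add: lpnorm_def einv_def powr_powr N_def)
    next
      case False
      have "(\<Sum>a\<in>A. \<bar>f a\<bar> powr s) powr (t / s) \<le> N powr (t / s - 1) * (\<Sum>a\<in>A. (\<bar>f a\<bar> powr s) powr (t / s))"
        unfolding N_def using 4 False A by (intro power_mean_sum) auto
      then have "((\<Sum>a\<in>A. \<bar>f a\<bar> powr s) powr (t / s)) powr (1 / t)
          \<le> (N powr (t / s - 1) * (\<Sum>a\<in>A. \<bar>f a\<bar> powr t)) powr (1 / t)"
        using 4 by (intro powr_mono2) (auto simp: powr_powr)
      also have "\<dots> = N powr ((t / s - 1) / t) * (\<Sum>a\<in>A. \<bar>f a\<bar> powr t) powr (1 / t)"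
        using N by (simp add: powr_mult powr_powr sum_nonneg)
      also have "(t / s - 1) / t = 1 / s - 1 / t" using 4 by (simp add: field_simps)
      finally have "(\<Sum>a\<in>A. \<bar>f a\<bar> powr s) powr (1 / s) \<le> N powr (1 / s - 1 / t) * (\<Sum>a\<in>A. \<bar>f a\<bar> powr t) powr (1 / t)"
        using 4 by (simp add: powr_powr)
      moreover have "max (1 / s) (1 / t) = 1 / s" using 4 False by (simp add: max_def field_simps)
      ultimately show ?thesis using 4 by (simp add: lpnorm_def einv_def N_def)
    qed
  qed
qed

lemma lpnorm_Holder:
  assumes A: "finite A" "A \<noteq> {}" and p: "p \<ge> 1"
  shows "(\<Sum>a\<in>A. \<bar>f a\<bar> * \<bar>g a\<bar>) \<le> lpnorm (ereal p) f A * lpnorm (hconj p) g A"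
proof (cases "p = 1")
  case True
  have "(\<Sum>a\<in>A. \<bar>f a\<bar> * \<bar>g a\<bar>) \<le> (\<Sum>a\<in>A. \<bar>f a\<bar> * Max ((\<lambda>a. \<bar>g a\<bar>) ` A))"
    using A by (intro sum_mono mult_left_mono) auto
  then show ?thesis using True by (simp add: lpnorm_def hconj_def sum_nonneg flip: sum_distrib_right)
next
  case False
  then have "p > 1" "p / (p - 1) > 1" "1 / p + 1 / (p / (p - 1)) = 1"
    using p by (auto simp: field_simps)
  from sum_Holder[OF A(1) this, of "\<lambda>a. \<bar>f a\<bar>" "\<lambda>a. \<bar>g a\<bar>"]
  show ?thesis using False by (simp add: lpnorm_def hconj_def)
qed

section \<open>Rademacher sums\<close>

text \<open>Peels off the last coordinate. It drives two kinds of induction: adding one more sign,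
  and adding one more layer to a Pauli path.\<close>

lemma sum_PiE_Suc:
  fixes h :: "(nat \<Rightarrow> 'a) \<Rightarrow> 'b::comm_monoid_add"
  shows "(\<Sum>v\<in>PiE {..<Suc k} T. h v) = (\<Sum>w\<in>T k. \<Sum>v\<in>PiE {..<k} T. h (v(k := w)))"
proof -
  have inj: "inj_on (\<lambda>(w, v). v(k := w)) (T k \<times> PiE {..<k} T)"
  proof (rule inj_onI, clarify)
    fix w v w' v'
    assume v: "v \<in> PiE {..<k} T" "v' \<in> PiE {..<k} T" and eq: "v(k := w) = v'(k := w')"
    \<comment> \<open>At \<open>i = k\<close> the update hides the old values, but both functions
      lie in \<open>PiE {..<k} T\<close> and so are \<open>undefined\<close> there.\<close>
    have "v i = v' i" for i
      using fun_cong[OF eq, of i] PiE_arb[OF v(1), of k] PiE_arb[OF v(2), of k]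
      by (cases "i = k") auto
    then show "w = w' \<and> v = v'" using fun_cong[OF eq, of k] by auto
  qed
  have "PiE {..<Suc k} T = (\<lambda>(w, v). v(k := w)) ` (T k \<times> PiE {..<k} T)"
    by (simp add: lessThan_Suc PiE_insert_eq)
  then show ?thesis
    using sum.reindex[OF inj, of h] by (simp add: sum.cartesian_product case_prod_unfold)
qed

section \<open>Moments of scalar signed sums\<close>

abbreviation signs :: "nat \<Rightarrow> (nat \<Rightarrow> real) set" where
  "signs m \<equiv> PiE {..<m} (\<lambda>_. {-1, 1})"

lemma finite_signs: "finite (signs m)"
  by (intro finite_PiE) auto

lemma card_signs: "card (signs m) = 2 ^ m"
  by (simp add: card_PiE numeral_2_eq_2)

lemma sum_signs_Suc:
  "(\<Sum>\<epsilon>\<in>signs (Suc m). h (\<Sum>i<Suc m. \<epsilon> i * a i))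
    = (\<Sum>\<epsilon>\<in>signs m. h ((\<Sum>i<m. \<epsilon> i * a i) - a m) + h ((\<Sum>i<m. \<epsilon> i * a i) + a m))"
  for h :: "real \<Rightarrow> real"
  by (simp add: sum_PiE_Suc sum.distrib)

text \<open>Summing over the last sign cancels the cross term: \<open>(s - b)\<^sup>2 + (s +
  b)\<^sup>2 = 2 * s\<^sup>2 + 2 * b\<^sup>2\<close>.\<close>

lemma sum_signs_square:
  "(\<Sum>\<epsilon>\<in>signs m. (\<Sum>i<m. \<epsilon> i * a i)\<^sup>2) = 2 ^ m * (\<Sum>i<m. (a i)\<^sup>2)"
proof (induction m)
  case (Suc m)
  have "(\<Sum>\<epsilon>\<in>signs (Suc m). (\<Sum>i<Suc m. \<epsilon> i * a i)\<^sup>2)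
      = (\<Sum>\<epsilon>\<in>signs m. 2 * (\<Sum>i<m. \<epsilon> i * a i)\<^sup>2 + 2 * (a m)\<^sup>2)"
    by (simp only: sum_signs_Suc[of "\<lambda>x. x\<^sup>2"]) (simp add: power2_eq_square algebra_simps)
  also have "\<dots> = 2 * (2 ^ m * (\<Sum>i<m. (a i)\<^sup>2)) + 2 ^ m * (2 * (a m)\<^sup>2)"
    by (simp add: sum.distrib card_signs Suc.IH flip: sum_distrib_left)
  also have "\<dots> = 2 ^ Suc m * (\<Sum>i<Suc m. (a i)\<^sup>2)" by (simp add: algebra_simps)
  finally show ?case .
qed simp

text \<open>\<open>ln (cosh y)\<close> is the log-Laplace transform of a fair sign, so this is an instance of Hoeffding's lemma.\<close>
lemma cosh_le_exp_half_square: "cosh x \<le> exp (x\<^sup>2 / 2)" for x :: real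
proof -
  define y where "y = \<bar>x\<bar>"
  \<comment> \<open>With weight \<open>1 / 2\<close> and argument \<open>2 * y\<close> the logarithm
    becomes \<open>y + ln (cosh y)\<close>, the linear term \<open>- y\<close> cancels, and
    \<open>(2 * y)\<^sup>2 / 8\<close> is \<open>y\<^sup>2 / 2\<close>. As \<open>cosh\<close> is
    even, the nonnegative \<open>y\<close> suffices.\<close>
  have "- (2 * y) * (1 / 2) + ln (1 + 1 / 2 * (exp (2 * y) - 1)) \<le> (2 * y)\<^sup>2 / 8"
    by (rule Hoeffdings_lemma_aux) (auto simp: y_def)
  moreover have "1 + 1 / 2 * (exp (2 * y) - 1) = exp y * cosh y"
  proof -
    have "2 * y = y + y" by simp
    then have "exp (2 * y) = exp y * exp y" by (simp only: exp_add)
    then show ?thesis by (simp add: cosh_field_def distrib_left exp_minus add_divide_distrib diff_divide_distrib)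
  qed
  moreover have "ln (exp y * cosh y) = y + ln (cosh y)"
    by (subst ln_mult_pos) auto
  ultimately have "ln (cosh y) \<le> y\<^sup>2 / 2" by (simp add: power2_eq_square)
  then have "cosh y \<le> exp (y\<^sup>2 / 2)" using ln_ge_iff[of "cosh y"] by (metis cosh_real_pos exp_le_cancel_iff exp_ln)
  then show ?thesis by (simp add: y_def)
qed

text \<open>Independence of the signs makes the exponential moment a product of factors
  \<open>cosh (c * a i)\<close>, each with a Gaussian bound.\<close>

lemma sum_signs_exp_le:
  "(\<Sum>\<epsilon>\<in>signs m. exp (c * (\<Sum>i<m. \<epsilon> i * a i))) \<le> 2 ^ m * exp (c\<^sup>2 * (\<Sum>i<m. (a i)\<^sup>2) / 2)"
proof (induction m)
  case (Suc m)
  have cosh: "exp (c * (s - b)) + exp (c * (s + b)) = exp (c * s) * (2 * cosh (c * b))" for s b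
  proof -
    have "c * (s - b) = c * s + - (c * b)" "c * (s + b) = c * s + c * b"
      by (simp_all add: algebra_simps)
    then show ?thesis by (simp only: exp_add) (simp add: cosh_field_def distrib_left)
  qed
  have "(\<Sum>\<epsilon>\<in>signs (Suc m). exp (c * (\<Sum>i<Suc m. \<epsilon> i * a i)))
      = (\<Sum>\<epsilon>\<in>signs m. exp (c * (\<Sum>i<m. \<epsilon> i * a i)) * (2 * cosh (c * a m)))"
    by (simp only: sum_signs_Suc[of "\<lambda>x. exp (c * x)"] cosh)
  also have "\<dots> = (\<Sum>\<epsilon>\<in>signs m. exp (c * (\<Sum>i<m. \<epsilon> i * a i))) * (2 * cosh (c * a m))"
    by (simp only: sum_distrib_right)
  also have "\<dots> \<le> (2 ^ m * exp (c\<^sup>2 * (\<Sum>i<m. (a i)\<^sup>2) / 2)) * (2 * exp ((c * a m)\<^sup>2 / 2))"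
    using Suc.IH by (intro mult_mono cosh_le_exp_half_square) (auto intro: cosh_le_exp_half_square)
  also have "\<dots> = 2 ^ Suc m * exp (c\<^sup>2 * (\<Sum>i<Suc m. (a i)\<^sup>2) / 2)"
    by (simp add: power_mult_distrib distrib_left add_divide_distrib exp_add)
  finally show ?case .
qed simp

text \<open>The power \<open>\<bar>x\<bar> powr r\<close> is dominated by exponentials of
  \<open>c * x\<close> and \<open>- c * x\<close>, whose averages over the signs are sub-Gaussian.
  The resulting constant \<open>sqrt r\<close> is the square root of the dual exponent in the
  theorem.\<close>

lemma Khintchine_ge_2:
  assumes r: "r \<ge> 2"
  shows "(\<Sum>\<epsilon>\<in>signs m. \<bar>\<Sum>i<m. \<epsilon> i * a i\<bar> powr r) \<le> 2 ^ m * (r * (\<Sum>i<m. (a i)\<^sup>2)) powr (r / 2)"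
proof -
  define V where "V = (\<Sum>i<m. (a i)\<^sup>2)"
  have V0: "V \<ge> 0" by (auto simp: V_def intro: sum_nonneg)
  show ?thesis
  proof (cases "V = 0")
    case True
    then have "a i = 0" if "i < m" for i
      using that by (auto simp: V_def sum_nonneg_eq_0_iff)
    then have "(\<Sum>i<m. \<epsilon> i * a i) = 0" for \<epsilon> by (intro sum.neutral) auto
    then show ?thesis by simp
  next
    case False
    then have V: "V > 0" using V0 by simp
    define c where "c = sqrt (r / V)"
    have c: "c > 0" "c\<^sup>2 = r / V" using V r by (auto simp: c_def)
    have "c * sqrt (r * V) = sqrt (r * r)" using V by (simp add: c_def flip: real_sqrt_mult)
    then have rc: "r / c = sqrt (r * V)" using c r by (simp add: divide_eq_eq mult.commute)
    \<comment> \<open>Since \<open>r / c = sqrt (r * V)\<close>, this is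
      \<open>(r / c) powr r * exp (- r)\<close>, the constant left when
      \<open>u = c * \<bar>x\<bar> / r\<close> is scaled back to
      \<open>\<bar>x\<bar>\<close>.\<close>
    define K where "K = (r * V) powr (r / 2) * exp (- r)"
    have "(r / c) powr r = ((r * V) powr (1 / 2)) powr r"
      using V r by (simp add: rc powr_half_sqrt)
    then have rcr: "(r / c) powr r = (r * V) powr (r / 2)" by (simp add: powr_powr)
    \<comment> \<open>\<open>u \<le> exp (u - 1)\<close> with \<open>u = c\<bar>x\<bar>/r\<close> trades the power for an exponential; \<open>c = sqrt (r/V)\<close> optimises the result.\<close>
    have pointwise: "\<bar>x\<bar> powr r \<le> K * (exp (c * x) + exp (- c * x))" for x
    proof -
      define u where "u = c * \<bar>x\<bar> / r"
      have u: "u \<ge> 0" using c r by (simp add: u_def)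
      have "u \<le> exp (u - 1)" using exp_ge_add_one_self[of "u - 1"] by simp
      moreover have "(u - 1) * r = c * \<bar>x\<bar> - r" using r by (simp add: u_def left_diff_distrib)
      then have "exp (u - 1) powr r = exp (c * \<bar>x\<bar> - r)" by (simp add: exp_powr_real)
      ultimately have "u powr r \<le> exp (c * \<bar>x\<bar> - r)"
        using u r powr_mono2[of r u "exp (u - 1)"] by simp
      then have "(r / c) powr r * u powr r \<le> (r / c) powr r * exp (c * \<bar>x\<bar> - r)"
        by (intro mult_left_mono) auto
      moreover have "(r / c) powr r * u powr r = \<bar>x\<bar> powr r"
      proof -
        have "r / c * u = \<bar>x\<bar>" using c r by (simp add: u_def)
        then show ?thesis using powr_mult[of "r / c" u r] by simp
      qed
      moreover have "(r / c) powr r * exp (c * \<bar>x\<bar> - r) = K * exp (c * \<bar>x\<bar>)"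
        unfolding K_def rcr by (simp add: mult_exp_exp mult.assoc)
      moreover have "K * exp (c * \<bar>x\<bar>) \<le> K * (exp (c * x) + exp (- c * x))"
      proof (rule mult_left_mono)
        show "exp (c * \<bar>x\<bar>) \<le> exp (c * x) + exp (- c * x)"
          by (cases "x \<ge> 0") simp_all
      qed (simp add: K_def)
      ultimately show ?thesis by simp
    qed
    have "(\<Sum>\<epsilon>\<in>signs m. \<bar>\<Sum>i<m. \<epsilon> i * a i\<bar> powr r)
        \<le> (\<Sum>\<epsilon>\<in>signs m. K * (exp (c * (\<Sum>i<m. \<epsilon> i * a i)) + exp (- c * (\<Sum>i<m. \<epsilon> i * a i))))"
      by (intro sum_mono pointwise)
    also have "\<dots> = K * ((\<Sum>\<epsilon>\<in>signs m. exp (c * (\<Sum>i<m. \<epsilon> i * a i)))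
        + (\<Sum>\<epsilon>\<in>signs m. exp (- c * (\<Sum>i<m. \<epsilon> i * a i))))"
      by (simp only: sum.distrib flip: sum_distrib_left)
    also have "\<dots> \<le> K * (2 ^ m * exp (c\<^sup>2 * V / 2) + 2 ^ m * exp (c\<^sup>2 * V / 2))"
      using sum_signs_exp_le[of c a m] sum_signs_exp_le[of "- c" a m]
      by (intro mult_left_mono add_mono) (auto simp: K_def V_def)
    also have "c\<^sup>2 * V = r" using V c by simp
    also have "K * (2 ^ m * exp (r / 2) + 2 ^ m * exp (r / 2))
        = 2 ^ m * (r * V) powr (r / 2) * (2 * (exp (- r) * exp (r / 2)))"
      by (simp add: K_def)
    also have "\<dots> \<le> 2 ^ m * (r * V) powr (r / 2)"
    proof (rule mult_left_le)
      have eq: "exp (- r) * exp (r / 2) = inverse (exp (r / 2))"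
        by (simp add: mult_exp_exp flip: exp_minus)
      \<comment> \<open>The factor 2 counts the two exponentials that replace
        \<open>exp (c * \<bar>x\<bar>)\<close>. From \<open>r \<ge> 2\<close> follows
        \<open>exp (r / 2) \<ge> 1 + r / 2 \<ge> 2\<close>, which absorbs it.\<close>
      have "2 \<le> exp (r / 2)" using exp_ge_add_one_self[of "r / 2"] r by linarith
      then show "2 * (exp (- r) * exp (r / 2)) \<le> 1" unfolding eq by (simp add: field_simps)
    qed simp
    finally show ?thesis by (simp add: V_def)
  qed
qed

text \<open>Jensen passes to the second moment, which is explicit, and the Euclidean norm of
  \<open>a\<close> is at most its lr norm. Both comparisons use the exponent
  \<open>2 / r \<ge> 1\<close>, and neither leaves a constant.\<close>

lemma sum_signs_powr_le:
  assumes r: "0 < r" "r \<le> 2"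
  shows "(\<Sum>\<epsilon>\<in>signs m. \<bar>\<Sum>i<m. \<epsilon> i * a i\<bar> powr r) \<le> 2 ^ m * (\<Sum>i<m. \<bar>a i\<bar> powr r)"
proof -
  define X where "X = (\<Sum>\<epsilon>\<in>signs m. \<bar>\<Sum>i<m. \<epsilon> i * a i\<bar> powr r)"
  define V where "V = (\<Sum>i<m. (a i)\<^sup>2)"
  have X0: "X \<ge> 0" and V0: "V \<ge> 0" by (auto simp: X_def V_def intro: sum_nonneg)
  have sq: "(\<bar>x\<bar> powr r) powr (2 / r) = x\<^sup>2" for x
    using r by (simp add: powr_powr)
  have "X powr (2 / r) \<le> real (card (signs m)) powr (2 / r - 1) *
      (\<Sum>\<epsilon>\<in>signs m. (\<bar>\<Sum>i<m. \<epsilon> i * a i\<bar> powr r) powr (2 / r))"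
    unfolding X_def using r finite_signs by (intro power_mean_sum) auto
  also have "\<dots> = (2 ^ m) powr (2 / r - 1) * (2 ^ m * V)"
    by (simp only: sq sum_signs_square card_signs V_def) simp
  also have "\<dots> = (2 ^ m) powr (2 / r) * V" by (simp add: powr_diff)
  finally have "(X powr (2 / r)) powr (r / 2) \<le> ((2 ^ m) powr (2 / r) * V) powr (r / 2)"
    using r by (intro powr_mono2) auto
  then have "X \<le> 2 ^ m * V powr (r / 2)"
    using r X0 V0 by (simp add: powr_mult powr_powr)
  also have "V powr (r / 2) = ((\<Sum>i<m. (\<bar>a i\<bar> powr r) powr (2 / r))) powr (r / 2)"
    by (simp only: sq V_def)
  also have "\<dots> \<le> ((\<Sum>i<m. \<bar>a i\<bar> powr r) powr (2 / r)) powr (r / 2)"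
    using r by (intro powr_mono2 sum_powr_le_powr_sum) (auto intro: sum_nonneg)
  also have "\<dots> = (\<Sum>i<m. \<bar>a i\<bar> powr r)" using r by (simp add: powr_powr sum_nonneg)
  finally show ?thesis by (simp add: X_def)
qed

section \<open>Average lp norm of signed sums of vectors\<close>

text \<open>Jensen bounds the average norm by its r-th moment. The r-th power of the norm is a sum
  over coordinates, so exchanging sums leaves a scalar moment at each \<open>v\<close>.\<close>

lemma sum_signs_lpnorm_le:
  fixes f :: "nat \<Rightarrow> 'a \<Rightarrow> real"
  assumes r: "r \<ge> 1"
    and K: "\<And>v. v \<in> A \<Longrightarrow> (\<Sum>\<epsilon>\<in>signs m. \<bar>\<Sum>i<m. \<epsilon> i * f i v\<bar> powr r) \<le> 2 ^ m * K v"
  shows "(\<Sum>\<epsilon>\<in>signs m. lpnorm (ereal r) (\<lambda>v. \<Sum>i<m. \<epsilon> i * f i v) A) \<le> 2 ^ m * (\<Sum>v\<in>A. K v) powr (1 / r)"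
proof -
  define Y where "Y \<epsilon> = lpnorm (ereal r) (\<lambda>v. \<Sum>i<m. \<epsilon> i * f i v) A" for \<epsilon>
  have Y: "Y \<epsilon> \<ge> 0" for \<epsilon> by (simp add: Y_def lpnorm_ereal)
  have Yr: "Y \<epsilon> powr r = (\<Sum>v\<in>A. \<bar>\<Sum>i<m. \<epsilon> i * f i v\<bar> powr r)" for \<epsilon>
    using r by (simp add: Y_def lpnorm_ereal powr_powr sum_nonneg)
  have K0: "K v \<ge> 0" if "v \<in> A" for v
  proof -
    have "0 \<le> (\<Sum>\<epsilon>\<in>signs m. \<bar>\<Sum>i<m. \<epsilon> i * f i v\<bar> powr r)" by (intro sum_nonneg) auto
    also note K[OF that]
    finally show ?thesis using mult_le_cancel_left_pos[of "2 ^ m" 0 "K v"] by simp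
  qed
  have "(\<Sum>\<epsilon>\<in>signs m. Y \<epsilon>) powr r \<le> real (card (signs m)) powr (r - 1) * (\<Sum>\<epsilon>\<in>signs m. Y \<epsilon> powr r)"
    using r finite_signs Y by (intro power_mean_sum) auto
  also have "(\<Sum>\<epsilon>\<in>signs m. Y \<epsilon> powr r) = (\<Sum>v\<in>A. \<Sum>\<epsilon>\<in>signs m. \<bar>\<Sum>i<m. \<epsilon> i * f i v\<bar> powr r)"
    unfolding Yr by (rule sum.swap)
  also have "\<dots> \<le> (\<Sum>v\<in>A. 2 ^ m * K v)" by (intro sum_mono K)
  also have "real (card (signs m)) powr (r - 1) * (\<Sum>v\<in>A. 2 ^ m * K v) = (2 ^ m) powr r * (\<Sum>v\<in>A. K v)"
    by (simp add: card_signs powr_diff flip: sum_distrib_left)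
  finally have "((\<Sum>\<epsilon>\<in>signs m. Y \<epsilon>) powr r) powr (1 / r) \<le> ((2 ^ m) powr r * (\<Sum>v\<in>A. K v)) powr (1 / r)"
    using r by (intro powr_mono2) (auto simp: mult_left_mono)
  then show ?thesis
    using r Y K0 by (simp add: powr_mult powr_powr sum_nonneg Y_def)
qed

text \<open>Khintchine at each coordinate leaves a Euclidean norm over the \<open>m\<close> samples.
  The power mean inequality converts it into r-th powers at the price
  \<open>m powr (r / 2 - 1)\<close>; each sample then contributes at most \<open>D powr r\<close>,
  which makes \<open>m powr (r / 2)\<close> in all.\<close>

lemma sum_signs_lpnorm_ge_2:
  fixes f :: "nat \<Rightarrow> 'a \<Rightarrow> real"
  assumes m: "m > 0" and r: "r \<ge> 2" and D: "\<And>i. i < m \<Longrightarrow> lpnorm (ereal r) (f i) A \<le> D"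
  shows "(\<Sum>\<epsilon>\<in>signs m. lpnorm (ereal r) (\<lambda>v. \<Sum>i<m. \<epsilon> i * f i v) A) \<le> 2 ^ m * (sqrt r * sqrt m * D)"
proof -
  have "0 \<le> lpnorm (ereal r) (f 0) A" by (simp add: lpnorm_ereal)
  also note D[OF m]
  finally have D0: "D \<ge> 0" .
  have Dr: "(\<Sum>v\<in>A. \<bar>f i v\<bar> powr r) \<le> D powr r" if "i < m" for i
    using r D[OF that] by (intro sum_powr_le_of_lpnorm_le) auto
  have "(\<Sum>\<epsilon>\<in>signs m. lpnorm (ereal r) (\<lambda>v. \<Sum>i<m. \<epsilon> i * f i v) A)
      \<le> 2 ^ m * (\<Sum>v\<in>A. (r * (\<Sum>i<m. (f i v)\<^sup>2)) powr (r / 2)) powr (1 / r)"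
    using r by (intro sum_signs_lpnorm_le Khintchine_ge_2) auto
  also have "(\<Sum>v\<in>A. (r * (\<Sum>i<m. (f i v)\<^sup>2)) powr (r / 2)) \<le> (sqrt r * sqrt m * D) powr r"
  proof -
    have "(r * (\<Sum>i<m. (f i v)\<^sup>2)) powr (r / 2) \<le> r powr (r / 2) * m powr (r / 2 - 1) * (\<Sum>i<m. \<bar>f i v\<bar> powr r)" for v
    proof -
      have "(\<Sum>i<m. (f i v)\<^sup>2) powr (r / 2) \<le> real (card {..<m}) powr (r / 2 - 1) * (\<Sum>i<m. ((f i v)\<^sup>2) powr (r / 2))"
        using r by (intro power_mean_sum) auto
      moreover have "(x\<^sup>2) powr (r / 2) = \<bar>x\<bar> powr r" for x :: real
      proof -
        have "x\<^sup>2 = \<bar>x\<bar> powr 2" by simp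
        then show ?thesis by (simp only: powr_powr) simp
      qed
      ultimately show ?thesis using r
        by (simp add: powr_mult sum_nonneg mult_left_mono mult.assoc)
    qed
    then have "(\<Sum>v\<in>A. (r * (\<Sum>i<m. (f i v)\<^sup>2)) powr (r / 2))
        \<le> (\<Sum>v\<in>A. r powr (r / 2) * m powr (r / 2 - 1) * (\<Sum>i<m. \<bar>f i v\<bar> powr r))"
      by (intro sum_mono)
    also have "\<dots> = r powr (r / 2) * m powr (r / 2 - 1) * (\<Sum>i<m. \<Sum>v\<in>A. \<bar>f i v\<bar> powr r)"
      by (subst sum.swap) (simp add: sum_distrib_left)
    also have "\<dots> \<le> r powr (r / 2) * m powr (r / 2 - 1) * (\<Sum>i<m. D powr r)"
      by (intro mult_left_mono sum_mono Dr) auto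
    also have "\<dots> = r powr (r / 2) * m powr (r / 2) * D powr r"
      using m by (simp add: powr_diff)
    also have "\<dots> = (sqrt r * sqrt m * D) powr r"
    proof -
      have "sqrt x powr r = x powr (r / 2)" if "x \<ge> 0" for x
        using that powr_powr[of x "1 / 2" r] by (simp add: powr_half_sqrt)
      then show ?thesis using r D0 by (simp add: powr_mult)
    qed
    finally show ?thesis .
  qed
  then have "(\<Sum>v\<in>A. (r * (\<Sum>i<m. (f i v)\<^sup>2)) powr (r / 2)) powr (1 / r) \<le> ((sqrt r * sqrt m * D) powr r) powr (1 / r)"
    using r by (intro powr_mono2) (auto intro: sum_nonneg)
  also have "\<dots> = sqrt r * sqrt m * D" using r D0 by (simp add: powr_powr)
  finally show ?thesis by simp
qed

text \<open>The r-th powers of the norms merely add up over the samples, whence the growth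
  \<open>m powr (1 / r)\<close> in place of \<open>sqrt m\<close>. For \<open>r\<close> dual to
  \<open>p\<close>, division by \<open>m\<close> turns this into the rate
  \<open>1 / m powr (1 / p)\<close>.\<close>

lemma sum_signs_lpnorm_le_2:
  fixes f :: "nat \<Rightarrow> 'a \<Rightarrow> real"
  assumes m: "m > 0" and r: "1 \<le> r" "r \<le> 2" and D: "\<And>i. i < m \<Longrightarrow> lpnorm (ereal r) (f i) A \<le> D"
  shows "(\<Sum>\<epsilon>\<in>signs m. lpnorm (ereal r) (\<lambda>v. \<Sum>i<m. \<epsilon> i * f i v) A) \<le> 2 ^ m * (m powr (1 / r) * D)"
proof -
  have "0 \<le> lpnorm (ereal r) (f 0) A" by (simp add: lpnorm_ereal)
  also note D[OF m]
  finally have D0: "D \<ge> 0" .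
  have Dr: "(\<Sum>v\<in>A. \<bar>f i v\<bar> powr r) \<le> D powr r" if "i < m" for i
    using r D[OF that] by (intro sum_powr_le_of_lpnorm_le) auto
  have "(\<Sum>\<epsilon>\<in>signs m. lpnorm (ereal r) (\<lambda>v. \<Sum>i<m. \<epsilon> i * f i v) A)
      \<le> 2 ^ m * (\<Sum>v\<in>A. \<Sum>i<m. \<bar>f i v\<bar> powr r) powr (1 / r)"
    using r by (intro sum_signs_lpnorm_le sum_signs_powr_le) auto
  also have "(\<Sum>v\<in>A. \<Sum>i<m. \<bar>f i v\<bar> powr r) \<le> m * D powr r"
    using sum_mono[of "{..<m}", OF Dr] by (subst sum.swap) simp
  then have "(\<Sum>v\<in>A. \<Sum>i<m. \<bar>f i v\<bar> powr r) powr (1 / r) \<le> (m * D powr r) powr (1 / r)"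
    using r by (intro powr_mono2) (auto intro!: sum_nonneg)
  also have "\<dots> = m powr (1 / r) * D" using r D0 by (simp add: powr_mult powr_powr)
  finally show ?thesis by simp
qed

text \<open>On \<open>4 ^ k\<close> coordinates all norms of exponent at least \<open>4 * k\<close>
  agree up to a factor \<open>sqrt 2\<close>, so a large or infinite \<open>r\<close> can be traded
  for a finite exponent proportional to \<open>k\<close>. This covers \<open>p = 1\<close>, where
  the dual norm is a maximum.\<close>

lemma sum_signs_lpnorm_min:
  fixes f :: "nat \<Rightarrow> 'a \<Rightarrow> real"
  assumes m: "m > 0" and A: "finite A" "card A = 4 ^ k" and k: "k \<ge> 1" and r: "r \<ge> 2"
    and D: "\<And>i. i < m \<Longrightarrow> lpnorm r (f i) A \<le> D"
  shows "(\<Sum>\<epsilon>\<in>signs m. lpnorm r (\<lambda>v. \<Sum>i<m. \<epsilon> i * f i v) A)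
    \<le> 2 ^ m * (sqrt (real_of_ereal (min r (ereal (8 * k)))) * sqrt m * D)"
proof (cases "r \<le> ereal (8 * k)")
  case True
  then obtain s where "r = ereal s" "s \<ge> 2" "s \<le> 8 * k" using r by (cases r) auto
  then show ?thesis using sum_signs_lpnorm_ge_2[OF m, of s f A D] D True by (simp add: min_def)
next
  case False
  \<comment> \<open>The exponent \<open>4 k\<close> costs only \<open>(4 ^ k) powr (1/(4 k)) = sqrt 2\<close> in changing norms, and \<open>sqrt (4 k) * sqrt 2 = sqrt (8 k)\<close>.\<close>
  define s where "s = real (4 * k)"
  have s: "s \<ge> 2" "s > 0" using k by (auto simp: s_def)
  have ne: "A \<noteq> {}" using A by auto
  have r0: "0 < r" using r by (cases r) auto
  have sr: "einv r \<le> 1 / s"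
  proof (cases r)
    case (real x)
    then show ?thesis using False k by (auto simp: einv_def s_def intro!: divide_left_mono)
  qed (use r k in \<open>auto simp: einv_def s_def\<close>)
  have e0: "einv r \<ge> 0" using r by (cases r) (auto simp: einv_def)
  have D0: "D \<ge> 0" using D[OF m] lpnorm_nonneg[OF A(1) ne, of r "f 0"] by linarith
  have Ds: "lpnorm (ereal s) (f i) A \<le> sqrt 2 * D" if "i < m" for i
  proof -
    have "lpnorm (ereal s) (f i) A \<le> real (card A) powr (max (einv (ereal s)) (einv r) - einv r) * lpnorm r (f i) A"
      using s r0 A ne by (intro lpnorm_le_lpnorm) auto
    also have "\<dots> \<le> real (card A) powr (1 / s) * D"
      using e0 sr A D[OF that] lpnorm_nonneg[OF A(1) ne]
      by (intro mult_mono powr_mono) (auto simp: einv_def max_def)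
    also have "real (card A) powr (1 / s) = sqrt 2"
    proof -
      have "real (card A) = 2 ^ (2 * k)" by (simp add: A power_mult)
      also have "\<dots> = 2 powr (2 * k)" by (simp only: powr_realpow zero_less_numeral)
      finally have "real (card A) powr (1 / s) = 2 powr (2 * k * (1 / s))" by (simp only: powr_powr)
      also have "2 * k * (1 / s) = 1 / 2" using k by (simp add: s_def)
      finally show ?thesis by (simp add: powr_half_sqrt)
    qed
    finally show ?thesis .
  qed
  have "lpnorm r g A \<le> lpnorm (ereal s) g A" for g
    using lpnorm_le_lpnorm[OF A(1) ne r0, of "ereal s" g] s sr A by (simp add: einv_def)
  then have "(\<Sum>\<epsilon>\<in>signs m. lpnorm r (\<lambda>v. \<Sum>i<m. \<epsilon> i * f i v) A)
      \<le> (\<Sum>\<epsilon>\<in>signs m. lpnorm (ereal s) (\<lambda>v. \<Sum>i<m. \<epsilon> i * f i v) A)" by (intro sum_mono)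
  also have "\<dots> \<le> 2 ^ m * (sqrt s * sqrt m * (sqrt 2 * D))"
    by (intro sum_signs_lpnorm_ge_2 m s Ds)
  also have "\<dots> = 2 ^ m * (sqrt (s * 2) * sqrt m * D)" by (simp add: real_sqrt_mult)
  also have "s * 2 = real_of_ereal (min r (ereal (8 * k)))" using False by (simp add: min_def s_def)
  finally show ?thesis .
qed

section \<open>Pauli expansions\<close>

lemma finite_pstrs: "finite (pstrs n)"
  and card_pstrs: "card (pstrs n) = 4 ^ n"
proof -
  have "pstrs n = {z. set z \<subseteq> {0..<4} \<and> length z = n}" by (auto simp: pstrs_def)
  then show "finite (pstrs n)" "card (pstrs n) = 4 ^ n"
    using finite_lists_length_eq[of "{0..<4::nat}" n] card_lists_length_eq[of "{0..<4::nat}" n] by auto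
qed

lemma pstrs_nonempty: "pstrs n \<noteq> {}"
  using card_pstrs[of n] by auto

lemma sum_pstrs_Suc: "(\<Sum>z\<in>pstrs (Suc n). h z) = (\<Sum>q<4. \<Sum>z\<in>pstrs n. h (q # z))"
proof -
  have "pstrs (Suc n) = (\<lambda>(q, z). q # z) ` ({..<4} \<times> pstrs n)"
    by (force simp: pstrs_def length_Suc_conv image_iff)
  moreover have "inj_on (\<lambda>(q, z). q # z) ({..<4} \<times> pstrs n)" by (auto intro: inj_onI)
  ultimately show ?thesis by (simp add: sum.reindex sum.cartesian_product case_prod_unfold)
qed

lemma pauli_carrier: "pauli z \<in> carrier_mat (2 ^ length z) (2 ^ length z)"
proof (induction z)
  case (Cons q z)
  then show ?case by (auto simp: kron_def pauli1_def mat_of_rows_list_def)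
qed simp

lemma pauli_carrier_pstrs: "z \<in> pstrs n \<Longrightarrow> pauli z \<in> carrier_mat (2 ^ n) (2 ^ n)"
  using pauli_carrier[of z] by (simp add: pstrs_def)

lemma pauli_Cons_index:
  assumes "i < 2 ^ Suc (length z)" "j < 2 ^ Suc (length z)"
  shows "pauli (q # z) $$ (i, j) = pauli1 q $$ (i div 2 ^ length z, j div 2 ^ length z)
    * pauli z $$ (i mod 2 ^ length z, j mod 2 ^ length z)"
proof -
  have "dim_row (pauli1 q) = 2" "dim_col (pauli1 q) = 2"
    by (auto simp: pauli1_def mat_of_rows_list_def)
  then show ?thesis using assms pauli_carrier[of z] by (simp add: kron_def)
qed

lemma pauli1_hermitian: "i < 2 \<Longrightarrow> j < 2 \<Longrightarrow> pauli1 q $$ (j, i) = cnj (pauli1 q $$ (i, j))"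
  by (auto simp: pauli1_def mat_of_rows_list_def less_2_cases_iff)

lemma pauli_hermitian:
  "i < 2 ^ length z \<Longrightarrow> j < 2 ^ length z \<Longrightarrow> pauli z $$ (j, i) = cnj (pauli z $$ (i, j))"
proof (induction z arbitrary: i j)
  case (Cons q z)
  then have "i div 2 ^ length z < 2" "j div 2 ^ length z < 2"
    by (auto simp: less_mult_imp_div_less)
  then show ?case
    using Cons.prems Cons.IH[of "i mod 2 ^ length z" "j mod 2 ^ length z"]
    by (simp add: pauli_Cons_index pauli1_hermitian[symmetric] del: pauli.simps)
qed simp

text \<open>In entries: the sum of \<open>P \<otimes> P\<close> over the four Pauli matrices is
  twice the swap operator. Verified case by case.\<close>

lemma pauli1_completeness:
  "a < 2 \<Longrightarrow> b < 2 \<Longrightarrow> c < 2 \<Longrightarrow> d < 2 \<Longrightarrow>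
    (\<Sum>q<4. pauli1 q $$ (a, b) * pauli1 q $$ (c, d)) = (if a = d \<and> b = c then 2 else 0)"
proof -
  have "(\<Sum>q<4. f q) = f 0 + f 1 + f 2 + f 3" for f :: "nat \<Rightarrow> complex"
    by (simp add: eval_nat_numeral)
  moreover assume "a < 2" "b < 2" "c < 2" "d < 2"
  ultimately show ?thesis
    by (auto dest!: less_2_cases simp: pauli1_def mat_of_rows_list_def)
qed

text \<open>The swap identity is multiplicative under tensor products: indices split into quotient
  and remainder modulo \<open>2 ^ n\<close>, the sum over strings factors into first letter and
  tail, and equality of indices splits likewise.\<close>

lemma pauli_completeness:
  "i < 2 ^ n \<Longrightarrow> j < 2 ^ n \<Longrightarrow> k < 2 ^ n \<Longrightarrow> l < 2 ^ n \<Longrightarrow>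
    (\<Sum>z\<in>pstrs n. pauli z $$ (i, j) * pauli z $$ (k, l)) = (if i = l \<and> j = k then 2 ^ n else 0)"
proof (induction n arbitrary: i j k l)
  case 0
  have "pstrs 0 = {[]}" by (auto simp: pstrs_def)
  then show ?case using 0 by simp
next
  case (Suc n)
  let ?N = "2 ^ n :: nat"
  have lt: "x div ?N < 2" "x mod ?N < ?N" if "x < 2 ^ Suc n" for x
    using that by (auto simp: less_mult_imp_div_less)
  have eq: "x = y \<longleftrightarrow> x div ?N = y div ?N \<and> x mod ?N = y mod ?N" for x y
    by (metis div_mult_mod_eq)
  have "(\<Sum>z\<in>pstrs (Suc n). pauli z $$ (i, j) * pauli z $$ (k, l))
      = (\<Sum>q<4. \<Sum>z\<in>pstrs n. (pauli1 q $$ (i div ?N, j div ?N) * pauli1 q $$ (k div ?N, l div ?N))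
        * (pauli z $$ (i mod ?N, j mod ?N) * pauli z $$ (k mod ?N, l mod ?N)))"
    unfolding sum_pstrs_Suc
  proof (intro sum.cong refl)
    fix q z assume "z \<in> pstrs n"
    then have "length z = n" by (simp add: pstrs_def)
    then show "pauli (q # z) $$ (i, j) * pauli (q # z) $$ (k, l)
      = (pauli1 q $$ (i div ?N, j div ?N) * pauli1 q $$ (k div ?N, l div ?N))
        * (pauli z $$ (i mod ?N, j mod ?N) * pauli z $$ (k mod ?N, l mod ?N))"
      using Suc.prems pauli_Cons_index[of i z j q] pauli_Cons_index[of k z l q]
      by (simp del: pauli.simps)
  qed
  also have "\<dots> = (\<Sum>q<4. pauli1 q $$ (i div ?N, j div ?N) * pauli1 q $$ (k div ?N, l div ?N))
      * (\<Sum>z\<in>pstrs n. pauli z $$ (i mod ?N, j mod ?N) * pauli z $$ (k mod ?N, l mod ?N))"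
    by (simp only: sum_product)
  also have "\<dots> = (if i = l \<and> j = k then 2 ^ Suc n else 0)"
    using Suc.prems by (subst pauli1_completeness, (simp_all only: lt)[4], subst Suc.IH, (simp_all only: lt)[4])
      (auto simp: eq[of i l] eq[of j k])
  finally show ?case .
qed

section \<open>Coordinates of matrices and channels in the Pauli basis\<close>

lemma mtrace_mult:
  "A \<in> carrier_mat d d \<Longrightarrow> B \<in> carrier_mat d d \<Longrightarrow> mtrace (A * B) = (\<Sum>i<d. \<Sum>j<d. A $$ (i, j) * B $$ (j, i))"
  by (auto simp: mtrace_def scalar_prod_def atLeast0LessThan intro!: sum.cong)

text \<open>The normalisation makes these the coordinates in the Pauli basis, as
  \<open>pauli z * pauli z\<close> has trace \<open>2 ^ n\<close>. For an encoded state they are the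
  entries of the vector f_I.\<close>

definition pauli_coeff :: "nat \<Rightarrow> complex mat \<Rightarrow> nat list \<Rightarrow> complex" where
  "pauli_coeff n A z = mtrace (pauli z * A) / 2 ^ n"

text \<open>Written out, the traces pair entries of \<open>A\<close> with products of Pauli entries;
  completeness kills all entries of \<open>A\<close> but \<open>(k, l)\<close>, which survives with
  weight \<open>2 ^ n\<close>.\<close>

lemma pauli_expansion:
  assumes A: "A \<in> carrier_mat (2 ^ n) (2 ^ n)" and k: "k < 2 ^ n" and l: "l < 2 ^ n"
  shows "A $$ (k, l) = (\<Sum>z\<in>pstrs n. pauli_coeff n A z * pauli z $$ (k, l))"
proof -
  have "(\<Sum>z\<in>pstrs n. mtrace (pauli z * A) * pauli z $$ (k, l))
      = (\<Sum>z\<in>pstrs n. \<Sum>i<2^n. \<Sum>j<2^n. A $$ (j, i) * (pauli z $$ (i, j) * pauli z $$ (k, l)))"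
    by (intro sum.cong refl)
      (simp add: mtrace_mult[OF pauli_carrier_pstrs A] sum_distrib_left sum_distrib_right mult_ac)
  also have "\<dots> = (\<Sum>i<2^n. \<Sum>j<2^n. \<Sum>z\<in>pstrs n. A $$ (j, i) * (pauli z $$ (i, j) * pauli z $$ (k, l)))"
    by (subst sum.swap) (intro sum.cong refl sum.swap)
  also have "\<dots> = (\<Sum>i<2^n. \<Sum>j<2^n. if i = l then if j = k then 2 ^ n * A $$ (k, l) else 0 else 0)"
    using k l by (intro sum.cong refl) (simp add: pauli_completeness flip: sum_distrib_left)
  also have "\<dots> = (\<Sum>i<2^n. if i = l then 2 ^ n * A $$ (k, l) else 0)"
    using k by (intro sum.cong refl) simp
  also have "\<dots> = 2 ^ n * A $$ (k, l)" using l by simp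
  finally show ?thesis by (simp add: pauli_coeff_def flip: sum_divide_distrib)
qed

text \<open>The factor \<open>1 / 2 ^ n\<close> stays with the coordinates of \<open>A\<close>, so
  \<open>H\<close> enters through the unnormalised traces that make up \<alpha>.\<close>

lemma mtrace_mult_pauli_expansion:
  assumes A: "A \<in> carrier_mat (2 ^ n) (2 ^ n)" and H: "H \<in> carrier_mat (2 ^ n) (2 ^ n)"
  shows "mtrace (A * H) = (\<Sum>z\<in>pstrs n. pauli_coeff n A z * mtrace (pauli z * H))"
proof -
  have "mtrace (A * H) = (\<Sum>k<2^n. \<Sum>l<2^n. \<Sum>z\<in>pstrs n. pauli_coeff n A z * (pauli z $$ (k, l) * H $$ (l, k)))"
    by (simp add: mtrace_mult[OF A H] pauli_expansion[OF A] sum_distrib_right mult.assoc)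
  also have "\<dots> = (\<Sum>z\<in>pstrs n. \<Sum>k<2^n. \<Sum>l<2^n. pauli_coeff n A z * (pauli z $$ (k, l) * H $$ (l, k)))"
    by (subst sum.swap[of _ "pstrs n"]) (intro sum.cong refl sum.swap)
  also have "\<dots> = (\<Sum>z\<in>pstrs n. pauli_coeff n A z * mtrace (pauli z * H))"
    by (intro sum.cong refl) (simp add: mtrace_mult[OF pauli_carrier_pstrs H] sum_distrib_left)
  finally show ?thesis .
qed

text \<open>The trace of a product of two Hermitian matrices is real: conjugation transposes both
  factors, and exchanging the summation indices undoes this. Signed sums of states can thus be
  handled as real vectors.\<close>

lemma pauli_coeff_real:
  assumes z: "z \<in> pstrs n" and A: "A \<in> carrier_mat (2 ^ n) (2 ^ n)"
    and h: "\<And>i j. i < 2 ^ n \<Longrightarrow> j < 2 ^ n \<Longrightarrow> A $$ (j, i) = cnj (A $$ (i, j))"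
  shows "pauli_coeff n A z = of_real (Re (pauli_coeff n A z))"
proof -
  have len: "length z = n" using z by (simp add: pstrs_def)
  have "cnj (pauli z $$ (i, j) * A $$ (j, i)) = pauli z $$ (j, i) * A $$ (i, j)"
    if "i < 2 ^ n" "j < 2 ^ n" for i j
    using that h[of i j] pauli_hermitian[of i z j] len by simp
  then have "cnj (mtrace (pauli z * A)) = (\<Sum>i<2^n. \<Sum>j<2^n. pauli z $$ (j, i) * A $$ (i, j))"
    by (simp add: mtrace_mult[OF pauli_carrier_pstrs[OF z] A])
  also have "\<dots> = mtrace (pauli z * A)"
    by (subst sum.swap) (simp add: mtrace_mult[OF pauli_carrier_pstrs[OF z] A])
  finally have "cnj (pauli_coeff n A z) = pauli_coeff n A z" by (simp add: pauli_coeff_def)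
  then show ?thesis by (metis Reals_cnj_iff of_real_Re)
qed

lemma linear_map_sum:
  fixes \<Phi> :: "complex mat \<Rightarrow> complex mat" and c :: "'a \<Rightarrow> complex"
  assumes carr: "\<And>X. X \<in> carrier_mat d d \<Longrightarrow> \<Phi> X \<in> carrier_mat e e"
    and lin: "\<And>c X Y. X \<in> carrier_mat d d \<Longrightarrow> Y \<in> carrier_mat d d \<Longrightarrow> \<Phi> (c \<cdot>\<^sub>m X + Y) = c \<cdot>\<^sub>m \<Phi> X + \<Phi> Y"
    and S: "finite S" "\<And>x. x \<in> S \<Longrightarrow> P x \<in> carrier_mat d d"
  shows "\<Phi> (Matrix.mat d d (\<lambda>ij. \<Sum>x\<in>S. c x * P x $$ ij)) = Matrix.mat e e (\<lambda>ij. \<Sum>x\<in>S. c x * \<Phi> (P x) $$ ij)"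
  using S
proof (induction S rule: finite_induct)
  case empty
  have Z: "0\<^sub>m d d \<in> carrier_mat d d" by simp
  \<comment> \<open>Linearity with \<open>c = -1\<close> and both matrices zero shows that the image
    of zero is its own negative plus itself, hence zero.\<close>
  have "(-1) \<cdot>\<^sub>m 0\<^sub>m d d + 0\<^sub>m d d = (0\<^sub>m d d :: complex mat)" by (intro eq_matI) auto
  then have "\<Phi> (0\<^sub>m d d) = (-1) \<cdot>\<^sub>m \<Phi> (0\<^sub>m d d) + \<Phi> (0\<^sub>m d d)" using lin[OF Z Z, of "-1"] by simp
  also have "\<dots> = 0\<^sub>m e e" using carr[OF Z] by (intro eq_matI) auto
  finally show ?case by (simp add: zero_mat_def)
next
  case (insert x S)
  have "Matrix.mat d d (\<lambda>ij. \<Sum>y\<in>insert x S. c y * P y $$ ij) = c x \<cdot>\<^sub>m P x + Matrix.mat d d (\<lambda>ij. \<Sum>y\<in>S. c y * P y $$ ij)"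
    using insert.hyps insert.prems[of x] by (intro eq_matI) auto
  also have "\<Phi> \<dots> = c x \<cdot>\<^sub>m \<Phi> (P x) + \<Phi> (Matrix.mat d d (\<lambda>ij. \<Sum>y\<in>S. c y * P y $$ ij))"
    using insert.prems by (intro lin) auto
  also have "\<dots> = Matrix.mat e e (\<lambda>ij. \<Sum>y\<in>insert x S. c y * \<Phi> (P y) $$ ij)"
    using insert carr[of "P x"] by (intro eq_matI) auto
  finally show ?case .
qed

lemma qchannel_carrier: "qchannel a b \<Phi> \<Longrightarrow> X \<in> carrier_mat (2 ^ a) (2 ^ a) \<Longrightarrow> \<Phi> X \<in> carrier_mat (2 ^ b) (2 ^ b)"
  by (simp add: qchannel_def)

text \<open>\<open>repM\<close> is the matrix of the channel in Pauli coordinates: apply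
  \<open>\<Phi>\<close> termwise to the Pauli expansion of \<open>A\<close> and read off the
  coefficient at \<open>z\<close>.\<close>

lemma pauli_coeff_qchannel:
  assumes \<Phi>: "qchannel a b \<Phi>" and A: "A \<in> carrier_mat (2 ^ a) (2 ^ a)" and z: "z \<in> pstrs b"
  shows "pauli_coeff b (\<Phi> A) z = (\<Sum>x\<in>pstrs a. repM b \<Phi> z x * pauli_coeff a A x)"
proof -
  have "A = Matrix.mat (2^a) (2^a) (\<lambda>ij. \<Sum>x\<in>pstrs a. pauli_coeff a A x * pauli x $$ ij)"
    using A pauli_expansion[OF A] by (intro eq_matI) auto
  then have "\<Phi> A = \<Phi> \<dots>" by (rule arg_cong)
  also have "\<dots> = Matrix.mat (2^b) (2^b) (\<lambda>ij. \<Sum>x\<in>pstrs a. pauli_coeff a A x * \<Phi> (pauli x) $$ ij)"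
    using \<Phi> by (intro linear_map_sum finite_pstrs pauli_carrier_pstrs) (auto simp: qchannel_def)
  finally have ent: "\<Phi> A $$ (i, j) = (\<Sum>x\<in>pstrs a. pauli_coeff a A x * \<Phi> (pauli x) $$ (i, j))"
    if "i < 2 ^ b" "j < 2 ^ b" for i j using that by simp
  have "mtrace (pauli z * \<Phi> A)
      = (\<Sum>i<2^b. \<Sum>j<2^b. \<Sum>x\<in>pstrs a. pauli_coeff a A x * (pauli z $$ (i, j) * \<Phi> (pauli x) $$ (j, i)))"
    using \<Phi> A by (simp add: mtrace_mult[OF pauli_carrier_pstrs[OF z]] qchannel_carrier ent sum_distrib_left mult_ac)
  also have "\<dots> = (\<Sum>x\<in>pstrs a. \<Sum>i<2^b. \<Sum>j<2^b. pauli_coeff a A x * (pauli z $$ (i, j) * \<Phi> (pauli x) $$ (j, i)))"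
    by (subst sum.swap[of _ "pstrs a"]) (intro sum.cong refl sum.swap)
  also have "\<dots> = (\<Sum>x\<in>pstrs a. pauli_coeff a A x * mtrace (pauli z * \<Phi> (pauli x)))"
    using mtrace_mult[OF pauli_carrier_pstrs[OF z] qchannel_carrier[OF \<Phi> pauli_carrier_pstrs]]
    by (intro sum.cong refl) (simp add: sum_distrib_left)
  finally show ?thesis
    by (simp add: pauli_coeff_def[of b] repM_def sum_divide_distrib mult.commute)
qed

lemma circ_comp_carrier:
  assumes "\<Phi> \<in> circuits l n" "A \<in> carrier_mat (2 ^ n 0) (2 ^ n 0)" "k \<le> l"
  shows "circ_comp \<Phi> k A \<in> carrier_mat (2 ^ n k) (2 ^ n k)"
  using \<open>k \<le> l\<close>
proof (induction k)
  case (Suc k)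
  then have "qchannel (n k) (n (Suc k)) (\<Phi> (Suc k))" using assms(1) by (force simp: circuits_def)
  then show ?case using Suc by (simp add: qchannel_carrier)
qed (use assms in simp)

section \<open>Circuits and path norms\<close>

text \<open>For \<open>k = 0\<close> the path is the empty (undefined) function, so its starting point \<open>v 0\<close> has to be
  replaced by \<open>z\<close>.\<close>
lemma pauli_coeff_circ_comp:
  assumes \<Phi>: "\<Phi> \<in> circuits l n" and A: "A \<in> carrier_mat (2 ^ n 0) (2 ^ n 0)"
  shows "k \<le> l \<Longrightarrow> z \<in> pstrs (n k) \<Longrightarrow> pauli_coeff (n k) (circ_comp \<Phi> k A) z =
    (\<Sum>v\<in>PiE {..<k} (\<lambda>i. pstrs (n i)).
      (\<Prod>i\<in>{1..k}. repM (n i) (\<Phi> i) (if i = k then z else v i) (v (i - 1)))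
      * pauli_coeff (n 0) A (if k = 0 then z else v 0))"
proof (induction k arbitrary: z)
  case 0
  then show ?case by simp
next
  case (Suc k)
  let ?M = "\<lambda>i. repM (n i) (\<Phi> i)"
  have "qchannel (n k) (n (Suc k)) (\<Phi> (Suc k))"
    using \<Phi> Suc.prems by (force simp: circuits_def)
  then have "pauli_coeff (n (Suc k)) (circ_comp \<Phi> (Suc k) A) z
      = (\<Sum>w\<in>pstrs (n k). ?M (Suc k) z w * pauli_coeff (n k) (circ_comp \<Phi> k A) w)"
    using pauli_coeff_qchannel circ_comp_carrier[OF \<Phi> A] Suc.prems by simp
  also have "\<dots> = (\<Sum>w\<in>pstrs (n k). \<Sum>v\<in>PiE {..<k} (\<lambda>i. pstrs (n i)).
      (\<Prod>i\<in>{1..Suc k}. ?M i (if i = Suc k then z else (v(k := w)) i) ((v(k := w)) (i - 1)))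
      * pauli_coeff (n 0) A ((v(k := w)) 0))"
  proof (rule sum.cong[OF refl])
    fix w assume w: "w \<in> pstrs (n k)"
    \<comment> \<open>Vertex \<open>k\<close> is the source of factor \<open>Suc k\<close> and the
      target of factor \<open>k\<close>; all earlier vertices are read from \<open>v\<close>. At
      \<open>k = 0\<close> the new vertex is also the start of the path, which matches the default
      in the induction hypothesis.\<close>
    have "(\<Prod>i\<in>{1..Suc k}. ?M i (if i = Suc k then z else (v(k := w)) i) ((v(k := w)) (i - 1)))
        * pauli_coeff (n 0) A ((v(k := w)) 0)
      = ?M (Suc k) z w * ((\<Prod>i\<in>{1..k}. ?M i (if i = k then w else v i) (v (i - 1)))
        * pauli_coeff (n 0) A (if k = 0 then w else v 0))" for v
    proof -
      have "(\<Prod>i\<in>{1..k}. ?M i (if i = Suc k then z else (v(k := w)) i) ((v(k := w)) (i - 1)))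
          = (\<Prod>i\<in>{1..k}. ?M i (if i = k then w else v i) (v (i - 1)))"
        by (intro prod.cong refl) auto
      then show ?thesis by (simp add: prod.nat_ivl_Suc' mult.assoc)
    qed
    then show "?M (Suc k) z w * pauli_coeff (n k) (circ_comp \<Phi> k A) w
      = (\<Sum>v\<in>PiE {..<k} (\<lambda>i. pstrs (n i)).
      (\<Prod>i\<in>{1..Suc k}. ?M i (if i = Suc k then z else (v(k := w)) i) ((v(k := w)) (i - 1)))
      * pauli_coeff (n 0) A ((v(k := w)) 0))"
      using Suc.IH[OF _ w] Suc.prems by (simp only: sum_distrib_left)
  qed
  also have "\<dots> = (\<Sum>v\<in>PiE {..<Suc k} (\<lambda>i. pstrs (n i)).
      (\<Prod>i\<in>{1..Suc k}. ?M i (if i = Suc k then z else v i) (v (i - 1)))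
      * pauli_coeff (n 0) A (if Suc k = 0 then z else v 0))"
    by (simp only: sum_PiE_Suc) simp
  finally show ?case .
qed

section \<open>Sums over Pauli paths and comparison of path norms\<close>

text \<open>Writing \<open>g (v 0)\<close> as a product with factor 1 at every later position lets
  sum and product be exchanged, so each layer from \<open>1\<close> to \<open>l - 1\<close>
  contributes its cardinality.\<close>

lemma sum_PiE_head:
  fixes g :: "'a \<Rightarrow> real" and T :: "nat \<Rightarrow> 'a set"
  assumes l: "l \<ge> 1" and T: "\<And>i. finite (T i)"
  shows "(\<Sum>v\<in>PiE {..<l} T. g (v 0)) = (\<Prod>i\<in>{1..l-1}. real (card (T i))) * (\<Sum>x\<in>T 0. g x)"
proof -
  obtain k where k: "l = Suc k" using l by (cases l) auto
  have "(\<Sum>v\<in>PiE {..<l} T. g (v 0)) = (\<Sum>v\<in>PiE {..<l} T. \<Prod>i<l. if i = 0 then g (v i) else 1)"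
    using l by simp
  also have "\<dots> = (\<Prod>i<l. \<Sum>y\<in>T i. if i = 0 then g y else 1)"
    using T by (intro prod_sum_PiE[symmetric]) auto
  also have "\<dots> = (\<Sum>y\<in>T 0. g y) * (\<Prod>i<k. real (card (T (Suc i))))"
    by (simp only: k prod.lessThan_Suc_shift) simp
  finally show ?thesis by (simp add: k prod.atLeast1_atMost_eq mult.commute)
qed

lemma
  fixes l :: nat
  shows finite_paths: "finite (PiE {..<l} (\<lambda>i. pstrs (n i)))"
  and paths_nonempty: "PiE {..<l} (\<lambda>i. pstrs (n i)) \<noteq> {}"
  by (simp_all add: finite_PiE finite_pstrs PiE_eq_empty_iff pstrs_nonempty)

lemma path_head_mem:
  fixes l :: nat
  shows "v \<in> PiE {..<l} (\<lambda>i. pstrs (n i)) \<Longrightarrow> l \<ge> 1 \<Longrightarrow> v 0 \<in> pstrs (n 0)"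
  using PiE_mem[of v "{..<l}" "\<lambda>i. pstrs (n i)" 0] by simp

lemma hconj_pos: "1 \<le> p \<Longrightarrow> 0 < hconj p"
  by (simp add: hconj_def)

text \<open>The intermediate vertices are free, so they multiply the dual power sum by their number
  of choices and the norm by its root. For \<open>p = 1\<close> the dual norm is a maximum, which
  repeated values do not change, in line with \<open>einv \<infinity> = 0\<close>.\<close>

lemma lpnorm_PiE_head:
  fixes l :: nat
  assumes l: "l \<ge> 1" and p: "1 \<le> p"
  shows "lpnorm (hconj p) (\<lambda>v. g (v 0)) (PiE {..<l} (\<lambda>i. pstrs (n i)))
    \<le> (\<Prod>i\<in>{1..l-1}. 4 powr (real (n i) * einv (hconj p))) * lpnorm (hconj p) g (pstrs (n 0))"
proof (cases "p = 1")
  case True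
  let ?B = "PiE {..<l} (\<lambda>i. pstrs (n i))"
  have "\<bar>g (v 0)\<bar> \<le> Max ((\<lambda>x. \<bar>g x\<bar>) ` pstrs (n 0))" if "v \<in> ?B" for v
    using path_head_mem[OF that l] by (intro Max_ge) (auto simp: finite_pstrs)
  then show ?thesis using True by (simp add: finite_paths paths_nonempty lpnorm_def hconj_def einv_def)
next
  case False
  define r where "r = p / (p - 1)"
  have r: "hconj p = ereal r" "r > 0" using False p by (auto simp: r_def hconj_def)
  have pow: "4 powr (real k * einv (hconj p)) = real (4 ^ k) powr (1 / r)" for k
    by (simp add: r einv_def powr_powr flip: powr_realpow)
  have "(\<Sum>v\<in>PiE {..<l} (\<lambda>i. pstrs (n i)). \<bar>g (v 0)\<bar> powr r)
      = (\<Prod>i\<in>{1..l-1}. real (4 ^ n i)) * (\<Sum>x\<in>pstrs (n 0). \<bar>g x\<bar> powr r)"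
    using sum_PiE_head[OF l, where g = "\<lambda>x. \<bar>g x\<bar> powr r" and T = "\<lambda>i. pstrs (n i)"]
    by (simp add: finite_pstrs card_pstrs)
  then have "lpnorm (hconj p) (\<lambda>v. g (v 0)) (PiE {..<l} (\<lambda>i. pstrs (n i)))
      = (\<Prod>i\<in>{1..l-1}. real (4 ^ n i)) powr (1 / r) * lpnorm (hconj p) g (pstrs (n 0))"
    unfolding r lpnorm_ereal by (simp only: powr_mult)
  also have "(\<Prod>i\<in>{1..l-1}. real (4 ^ n i)) powr (1 / r) = (\<Prod>i\<in>{1..l-1}. 4 powr (real (n i) * einv (hconj p)))"
    by (simp only: pow prod_powr_distrib of_nat_0_le_iff)
  finally show ?thesis by simp
qed

lemma path_norm_nonneg: "path_norm p l n \<Phi> z \<ge> 0"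
  by (simp add: path_norm_def)

lemma path_sum_le:
  assumes l: "l \<ge> 1" and p: "1 \<le> p"
  shows "(\<Sum>v\<in>PiE {..<l} (\<lambda>i. pstrs (n i)).
      (\<Prod>i\<in>{1..l}. cmod (repM (n i) (\<Phi> i) (if i = l then z else v i) (v (i - 1)))) * \<bar>g (v 0)\<bar>)
    \<le> path_norm p l n \<Phi> z *
      ((\<Prod>i\<in>{1..l-1}. 4 powr (real (n i) * einv (hconj p))) * lpnorm (hconj p) g (pstrs (n 0)))"
    (is "?lhs \<le> _")
proof -
  let ?B = "PiE {..<l} (\<lambda>i. pstrs (n i))"
  define f where "f v = (\<Prod>i\<in>{1..l}. cmod (repM (n i) (\<Phi> i) (if i = l then z else v i) (v (i - 1))))" for v
  have f: "f v \<ge> 0" for v by (auto simp: f_def intro: prod_nonneg)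
  have "?lhs = (\<Sum>v\<in>?B. \<bar>f v\<bar> * \<bar>g (v 0)\<bar>)" unfolding f_def[symmetric] using f by simp
  also have "\<dots> \<le> lpnorm (ereal p) f ?B * lpnorm (hconj p) (\<lambda>v. g (v 0)) ?B"
    by (rule lpnorm_Holder[OF finite_paths paths_nonempty p])
  also have "lpnorm (ereal p) f ?B = path_norm p l n \<Phi> z"
    using f by (simp add: lpnorm_ereal path_norm_def f_def)
  also have "path_norm p l n \<Phi> z * lpnorm (hconj p) (\<lambda>v. g (v 0)) ?B \<le> path_norm p l n \<Phi> z *
      ((\<Prod>i\<in>{1..l-1}. 4 powr (real (n i) * einv (hconj p))) * lpnorm (hconj p) g (pstrs (n 0)))"
    by (intro mult_left_mono lpnorm_PiE_head l p path_norm_nonneg)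
  finally show ?thesis .
qed

text \<open>\<open>gamma_pq\<close> averages over the \<open>4 ^ n l\<close> output strings where
  \<open>lpnorm\<close> sums; the factor is the root of that normalisation and is 1 for
  \<open>q = \<infinity>\<close>.\<close>

lemma lpnorm_path_norm_eq:
  assumes q: "0 < q"
  shows "lpnorm q (path_norm p l n \<Phi>) (pstrs (n l)) = 4 powr (real (n l) * einv q) * gamma_pq p q l n \<Phi>"
proof (cases q)
  case (real r)
  have "(4 ^ n l :: real) = 4 powr real (n l)" by (simp add: powr_realpow)
  then have "(1 / 4 ^ n l * (\<Sum>z\<in>pstrs (n l). path_norm p l n \<Phi> z powr r)) powr (1 / r)
      = 4 powr - (real (n l) * (1 / r)) * (\<Sum>z\<in>pstrs (n l). path_norm p l n \<Phi> z powr r) powr (1 / r)"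
    by (simp add: powr_divide powr_powr powr_minus_divide)
  then show ?thesis
    using real by (simp add: lpnorm_ereal gamma_pq_def einv_def path_norm_nonneg powr_minus)
qed (use q in \<open>auto simp: lpnorm_def gamma_pq_def einv_def path_norm_nonneg\<close>)

text \<open>Passing from \<open>q\<close> to the dual exponent costs the maximum minus
  \<open>1 / q\<close> in the power of \<open>4 ^ n l\<close>; undoing the average in
  \<open>gamma_pq\<close> adds \<open>1 / q\<close> back.\<close>

lemma lpnorm_path_norm_le:
  assumes p: "1 \<le> p" and q: "0 < q"
  shows "lpnorm (hconj p) (path_norm p l n \<Phi>) (pstrs (n l))
    \<le> 4 powr (real (n l) * max (einv (hconj p)) (einv q)) * gamma_pq p q l n \<Phi>"
proof -
  let ?m = "max (einv (hconj p)) (einv q)"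
  have "real (card (pstrs (n l))) = 4 powr real (n l)" by (simp add: card_pstrs powr_realpow)
  then have "lpnorm (hconj p) (path_norm p l n \<Phi>) (pstrs (n l))
      \<le> 4 powr (real (n l) * (?m - einv q)) * lpnorm q (path_norm p l n \<Phi>) (pstrs (n l))"
    using lpnorm_le_lpnorm[OF finite_pstrs pstrs_nonempty hconj_pos[OF p] q, of "path_norm p l n \<Phi>" "n l"]
    by (simp add: powr_powr)
  also have "\<dots> = 4 powr (real (n l) * (?m - einv q) + real (n l) * einv q) * gamma_pq p q l n \<Phi>"
    by (simp only: lpnorm_path_norm_eq[OF q] powr_add mult.assoc)
  also have "real (n l) * (?m - einv q) + real (n l) * einv q = real (n l) * ?m"
    by (simp add: algebra_simps)
  finally show ?thesis .
qed

lemma pure_state_carrier: "pure_state n A \<Longrightarrow> A \<in> carrier_mat (2 ^ n) (2 ^ n)"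
  by (auto simp: pure_state_def)

lemma pauli_coeff_pure_state_real:
  assumes "pure_state n A" "z \<in> pstrs n"
  shows "pauli_coeff n A z = of_real (Re (pauli_coeff n A z))"
  using assms by (intro pauli_coeff_real pure_state_carrier) (auto simp: pure_state_def)

text \<open>The circuit enters the bound only through \<open>gamma_pq\<close> and the signs only
  through the last norm, so the supremum over the class can be taken at fixed signs, before
  averaging.\<close>

lemma abs_sum_model_fun_le:
  fixes \<epsilon> :: "nat \<Rightarrow> real"
  assumes l: "l \<ge> 1" and p: "1 \<le> p" and q: "0 < q" and H: "H \<in> carrier_mat (2 ^ n l) (2 ^ n l)"
    and \<rho>: "\<And>x. pure_state (n 0) (\<rho> x)" and \<Phi>: "\<Phi> \<in> circuits l n"
  shows "\<bar>\<Sum>i<m. \<epsilon> i * model_fun l \<Phi> \<rho> H (x i)\<bar>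
    \<le> gamma_pq p q l n \<Phi> * 4 powr (real (n l) * max (einv (hconj p)) (einv q))
      * (\<Prod>i\<in>{1..l-1}. 4 powr (real (n i) * einv (hconj p)))
      * lpnorm (ereal p) (\<lambda>z. cmod (mtrace (pauli z * H))) (pstrs (n l))
      * lpnorm (hconj p) (\<lambda>u. \<Sum>i<m. \<epsilon> i * Re (pauli_coeff (n 0) (\<rho> (x i)) u)) (pstrs (n 0))"
proof -
  let ?B = "PiE {..<l} (\<lambda>i. pstrs (n i))"
  define \<alpha> where "\<alpha> z = mtrace (pauli z * H)" for z
  define M where "M z v = (\<Prod>i\<in>{1..l}. repM (n i) (\<Phi> i) (if i = l then z else v i) (v (i - 1)))" for z v
  define F where "F u = (\<Sum>i<m. \<epsilon> i * Re (pauli_coeff (n 0) (\<rho> (x i)) u))" for u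
  define W where "W = (\<Prod>i\<in>{1..l-1}. 4 powr (real (n i) * einv (hconj p))) * lpnorm (hconj p) F (pstrs (n 0))"
  have W0: "W \<ge> 0" unfolding W_def
    by (intro mult_nonneg_nonneg prod_nonneg lpnorm_nonneg finite_pstrs pstrs_nonempty) auto
  have tr: "mtrace (circ_comp \<Phi> l (\<rho> y) * H)
      = (\<Sum>z\<in>pstrs (n l). \<Sum>v\<in>?B. \<alpha> z * M z v * of_real (Re (pauli_coeff (n 0) (\<rho> y) (v 0))))" for y
  proof -
    note carr = pure_state_carrier[OF \<rho>[of y]]
    have "mtrace (circ_comp \<Phi> l (\<rho> y) * H)
        = (\<Sum>z\<in>pstrs (n l). pauli_coeff (n l) (circ_comp \<Phi> l (\<rho> y)) z * \<alpha> z)"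
      unfolding \<alpha>_def by (intro mtrace_mult_pauli_expansion circ_comp_carrier[OF \<Phi> carr] H order_refl)
    also have "\<dots> = (\<Sum>z\<in>pstrs (n l). (\<Sum>v\<in>?B. M z v * pauli_coeff (n 0) (\<rho> y) (v 0)) * \<alpha> z)"
      using l by (intro sum.cong refl) (simp add: pauli_coeff_circ_comp[OF \<Phi> carr] M_def)
    also have "\<dots> = (\<Sum>z\<in>pstrs (n l). \<Sum>v\<in>?B. \<alpha> z * M z v * pauli_coeff (n 0) (\<rho> y) (v 0))"
      by (simp add: sum_distrib_left mult_ac)
    also have "\<dots> = (\<Sum>z\<in>pstrs (n l). \<Sum>v\<in>?B. \<alpha> z * M z v * of_real (Re (pauli_coeff (n 0) (\<rho> y) (v 0))))"
    proof (intro sum.cong refl)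
      fix z v assume "v \<in> ?B"
      then have "v 0 \<in> pstrs (n 0)" using l by (rule path_head_mem)
      from pauli_coeff_pure_state_real[OF \<rho> this, of y]
      show "\<alpha> z * M z v * pauli_coeff (n 0) (\<rho> y) (v 0)
        = \<alpha> z * M z v * of_real (Re (pauli_coeff (n 0) (\<rho> y) (v 0)))" by simp
    qed
    finally show ?thesis .
  qed
  have "(\<Sum>i<m. \<epsilon> i * model_fun l \<Phi> \<rho> H (x i)) = Re (\<Sum>i<m. of_real (\<epsilon> i) * mtrace (circ_comp \<Phi> l (\<rho> (x i)) * H))"
    by (simp add: model_fun_def)
  also have "(\<Sum>i<m. of_real (\<epsilon> i) * mtrace (circ_comp \<Phi> l (\<rho> (x i)) * H))
      = (\<Sum>i<m. \<Sum>z\<in>pstrs (n l). \<Sum>v\<in>?B. \<alpha> z * M z v * of_real (\<epsilon> i * Re (pauli_coeff (n 0) (\<rho> (x i)) (v 0))))"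
    by (simp add: tr sum_distrib_left mult_ac)
  \<comment> \<open>The path weights do not depend on the sample, so the sum over \<open>i\<close>
    moves innermost and the inputs merge into the single real vector \<open>F\<close>.\<close>
  also have "\<dots> = (\<Sum>z\<in>pstrs (n l). \<Sum>v\<in>?B. \<Sum>i<m. \<alpha> z * M z v * of_real (\<epsilon> i * Re (pauli_coeff (n 0) (\<rho> (x i)) (v 0))))"
    by (subst sum.swap) (intro sum.cong refl sum.swap)
  also have "\<dots> = (\<Sum>z\<in>pstrs (n l). \<Sum>v\<in>?B. \<alpha> z * M z v * of_real (F (v 0)))"
    by (simp add: F_def sum_distrib_left)
  finally have "\<bar>\<Sum>i<m. \<epsilon> i * model_fun l \<Phi> \<rho> H (x i)\<bar> \<le> cmod (\<Sum>z\<in>pstrs (n l). \<Sum>v\<in>?B. \<alpha> z * M z v * of_real (F (v 0)))"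
    by (simp only: abs_Re_le_cmod)
  also have "\<dots> \<le> (\<Sum>z\<in>pstrs (n l). \<Sum>v\<in>?B. cmod (\<alpha> z * M z v * of_real (F (v 0))))"
    by (intro sum_norm_le order_refl)
  also have "\<dots> = (\<Sum>z\<in>pstrs (n l). cmod (\<alpha> z) * (\<Sum>v\<in>?B. cmod (M z v) * \<bar>F (v 0)\<bar>))"
    by (simp add: norm_mult sum_distrib_left mult.assoc)
  also have "\<dots> \<le> (\<Sum>z\<in>pstrs (n l). cmod (\<alpha> z) * (path_norm p l n \<Phi> z * W))"
    unfolding M_def W_def prod_norm[symmetric] by (intro sum_mono mult_left_mono path_sum_le l p) auto
  also have "\<dots> = (\<Sum>z\<in>pstrs (n l). \<bar>cmod (\<alpha> z)\<bar> * \<bar>path_norm p l n \<Phi> z\<bar>) * W"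
    by (simp add: sum_distrib_right path_norm_nonneg mult.assoc)
  also have "\<dots> \<le> (lpnorm (ereal p) (\<lambda>z. cmod (\<alpha> z)) (pstrs (n l)) * lpnorm (hconj p) (path_norm p l n \<Phi>) (pstrs (n l))) * W"
    by (intro mult_right_mono lpnorm_Holder finite_pstrs pstrs_nonempty p W0)
  also have "\<dots> \<le> (lpnorm (ereal p) (\<lambda>z. cmod (\<alpha> z)) (pstrs (n l))
      * (4 powr (real (n l) * max (einv (hconj p)) (einv q)) * gamma_pq p q l n \<Phi>)) * W"
    by (intro mult_right_mono mult_left_mono lpnorm_path_norm_le p q W0 lpnorm_nonneg finite_pstrs pstrs_nonempty)
  also have "\<dots> = gamma_pq p q l n \<Phi> * 4 powr (real (n l) * max (einv (hconj p)) (einv q))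
      * (\<Prod>i\<in>{1..l-1}. 4 powr (real (n i) * einv (hconj p)))
      * lpnorm (ereal p) (\<lambda>z. cmod (\<alpha> z)) (pstrs (n l)) * lpnorm (hconj p) F (pstrs (n 0))"
    by (simp only: W_def mult_ac)
  finally show ?thesis unfolding \<alpha>_def F_def .
qed

section \<open>Averaging over the signs\<close>

text \<open>A bound uniform over \<open>G\<close> at each sign vector dominates the supremum; an
  empty \<open>G\<close> has supremum \<open>- \<infinity>\<close> and is covered as well.\<close>

lemma rademacher_le:
  assumes c: "\<And>\<epsilon> g. \<epsilon> \<in> signs (length xs) \<Longrightarrow> g \<in> G \<Longrightarrow> \<bar>\<Sum>i<length xs. \<epsilon> i * g (xs ! i)\<bar> \<le> b \<epsilon>"
    and s: "(\<Sum>\<epsilon>\<in>signs (length xs). b \<epsilon>) \<le> 2 ^ length xs * C"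
  shows "rademacher xs G \<le> ereal (C / real (length xs))"
proof -
  let ?c = "1 / (2 ^ length xs * real (length xs))"
  have "rademacher xs G \<le> ereal ?c * (\<Sum>\<epsilon>\<in>signs (length xs). ereal (b \<epsilon>))"
    unfolding rademacher_def by (intro ereal_mult_left_mono sum_mono SUP_least) (auto intro: c)
  also have "\<dots> = ereal (?c * (\<Sum>\<epsilon>\<in>signs (length xs). b \<epsilon>))" by simp
  also have "\<dots> \<le> ereal (?c * (2 ^ length xs * C))"
    using s by (intro ereal_less_eq(3)[THEN iffD2] mult_left_mono) auto
  finally show ?thesis by simp
qed

text \<open>\<open>growth\<close> isolates the probabilistic input: signed sums of vectors of dual
  norm at most \<open>D\<close> have average norm at most \<open>K * D\<close>. The two ranges of
  \<open>p\<close> then differ only in \<open>K\<close>.\<close>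

lemma rademacher_model_class_le:
  fixes l :: nat and n :: "nat \<Rightarrow> nat" and \<gamma> p :: real and q :: ereal
    and \<rho> :: "'x \<Rightarrow> complex mat" and xs :: "'x list"
  assumes l: "l \<ge> 1" and \<gamma>: "\<gamma> > 0" and p: "1 \<le> p" and q: "0 < q"
    and H: "H \<in> carrier_mat (2 ^ n l) (2 ^ n l)" and \<rho>: "\<And>x. pure_state (n 0) (\<rho> x)" and xs: "xs \<noteq> []"
    and growth: "\<And>(f :: nat \<Rightarrow> nat list \<Rightarrow> real) D.
      (\<And>i. i < length xs \<Longrightarrow> lpnorm (hconj p) (f i) (pstrs (n 0)) \<le> D) \<Longrightarrow>
      (\<Sum>\<epsilon>\<in>signs (length xs). lpnorm (hconj p) (\<lambda>v. \<Sum>i<length xs. \<epsilon> i * f i v) (pstrs (n 0)))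
        \<le> 2 ^ length xs * (K * D)"
  shows "rademacher xs (model_class p q \<gamma> l n \<rho> H) \<le>
    ereal (\<gamma> * 4 powr (real (n l) * max (einv (hconj p)) (einv q)) *
      (\<Prod>i\<in>{1..l-1}. 4 powr (real (n i) * einv (hconj p))) * (K / real (length xs)) *
      Kp p (n 0) (n l) \<rho> xs H)"
proof -
  let ?m = "length xs"
  define f where "f i u = Re (pauli_coeff (n 0) (\<rho> (xs ! i)) u)" for i u
  define D where "D = Max ((\<lambda>i. lpnorm (hconj p) (\<lambda>z. cmod (mtrace (pauli z * \<rho> (xs ! i))) / 2 ^ n 0) (pstrs (n 0))) ` {..<?m})"
  define \<alpha> where "\<alpha> = lpnorm (ereal p) (\<lambda>z. cmod (mtrace (pauli z * H))) (pstrs (n l))"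
  define c where "c = 4 powr (real (n l) * max (einv (hconj p)) (einv q))
    * (\<Prod>i\<in>{1..l-1}. 4 powr (real (n i) * einv (hconj p)))"
  have \<alpha>0: "\<alpha> \<ge> 0" by (auto simp: \<alpha>_def intro!: lpnorm_nonneg finite_pstrs pstrs_nonempty)
  have c0: "c \<ge> 0" unfolding c_def by (intro mult_nonneg_nonneg prod_nonneg) auto
  have "lpnorm (hconj p) (f i) (pstrs (n 0)) \<le> D" if "i < ?m" for i
  proof -
    \<comment> \<open>Pauli coordinates of a state are real, so the real part loses nothing and
      \<open>f i\<close> has the norm that occurs in \<open>Kp\<close>.\<close>
    have "\<bar>f i u\<bar> = \<bar>cmod (mtrace (pauli u * \<rho> (xs ! i))) / 2 ^ n 0\<bar>" if "u \<in> pstrs (n 0)" for u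
    proof -
      have "\<bar>f i u\<bar> = cmod (of_real (f i u))" by simp
      also have "\<dots> = cmod (pauli_coeff (n 0) (\<rho> (xs ! i)) u)"
        using pauli_coeff_pure_state_real[OF \<rho> that, of "xs ! i"] by (simp only: f_def)
      finally show ?thesis by (simp add: pauli_coeff_def norm_divide norm_power)
    qed
    then have "lpnorm (hconj p) (f i) (pstrs (n 0))
        = lpnorm (hconj p) (\<lambda>z. cmod (mtrace (pauli z * \<rho> (xs ! i))) / 2 ^ n 0) (pstrs (n 0))"
      by (rule lpnorm_cong)
    also have "\<dots> \<le> D" using that by (auto simp: D_def)
    finally show ?thesis .
  qed
  from growth[OF this]
  have "(\<Sum>\<epsilon>\<in>signs ?m. \<gamma> * c * \<alpha> * lpnorm (hconj p) (\<lambda>v. \<Sum>i<?m. \<epsilon> i * f i v) (pstrs (n 0)))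
      \<le> \<gamma> * c * \<alpha> * (2 ^ ?m * (K * D))"
    unfolding sum_distrib_left[symmetric] using \<gamma> c0 \<alpha>0 by (intro mult_left_mono) auto
  then have "rademacher xs (model_class p q \<gamma> l n \<rho> H) \<le> ereal (\<gamma> * c * \<alpha> * (K * D) / real ?m)"
  proof (intro rademacher_le)
    fix \<epsilon> :: "nat \<Rightarrow> real" and g assume "g \<in> model_class p q \<gamma> l n \<rho> H"
    then obtain \<Phi> where \<Phi>: "\<Phi> \<in> circuits l n" "gamma_pq p q l n \<Phi> \<le> \<gamma>" and g: "g = model_fun l \<Phi> \<rho> H"
      by (auto simp: model_class_def)
    let ?F = "lpnorm (hconj p) (\<lambda>v. \<Sum>i<?m. \<epsilon> i * f i v) (pstrs (n 0))"
    have "\<bar>\<Sum>i<?m. \<epsilon> i * g (xs ! i)\<bar> \<le> gamma_pq p q l n \<Phi> * c * \<alpha> * ?F"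
      using abs_sum_model_fun_le[OF l p q H \<rho> \<Phi>(1), where \<epsilon> = \<epsilon> and x = "\<lambda>i. xs ! i" and m = ?m]
      by (simp add: g f_def c_def \<alpha>_def mult.assoc)
    also have "\<dots> \<le> \<gamma> * c * \<alpha> * ?F"
      using \<Phi>(2) c0 \<alpha>0 by (intro mult_right_mono lpnorm_nonneg finite_pstrs pstrs_nonempty)
    finally show "\<bar>\<Sum>i<?m. \<epsilon> i * g (xs ! i)\<bar> \<le> \<gamma> * c * \<alpha> * ?F" .
  qed (simp add: mult_ac)
  also have "\<gamma> * c * \<alpha> * (K * D) / real ?m = \<gamma> * 4 powr (real (n l) * max (einv (hconj p)) (einv q)) *
      (\<Prod>i\<in>{1..l-1}. 4 powr (real (n i) * einv (hconj p))) * (K / real ?m) * Kp p (n 0) (n l) \<rho> xs H"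
    by (simp add: c_def \<alpha>_def D_def Kp_def)
  finally show ?thesis .
qed

theorem mainTheorem7:
  fixes l :: nat and n :: "nat \<Rightarrow> nat" and \<gamma> p :: real and q :: ereal
    and \<rho> :: "'x \<Rightarrow> complex mat" and H :: "complex mat" and xs :: "'x list"
  assumes "l \<ge> 1"
    and "\<forall>i\<le>l. n i \<ge> 1"
    and "\<gamma> > 0"
    and "1 \<le> p"
    and "0 < q"
    and "hermitian_mat (2 ^ n l) H"
    and "\<forall>x. pure_state (n 0) (\<rho> x)"
    and "xs \<noteq> []"
  shows "(p \<le> 2 \<longrightarrow>
           rademacher xs (model_class p q \<gamma> l n \<rho> H) \<le>
           ereal (\<gamma> * 4 powr (real (n l) * max (einv (hconj p)) (einv q)) *
                  (\<Prod>i\<in>{1..l-1}. 4 powr (real (n i) * einv (hconj p))) *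
                  (sqrt (real_of_ereal (min (hconj p) (ereal (8 * real (n 0))))) / sqrt (real (length xs))) *
                  Kp p (n 0) (n l) \<rho> xs H))
       \<and> (2 < p \<longrightarrow>
           rademacher xs (model_class p q \<gamma> l n \<rho> H) \<le>
           ereal (\<gamma> * 4 powr (real (n l) * max (einv (hconj p)) (einv q)) *
                  (\<Prod>i\<in>{1..l-1}. 4 powr (real (n i) * einv (hconj p))) *
                  (sqrt (real_of_ereal (hconj p)) / real (length xs) powr (1 / p)) *
                  Kp p (n 0) (n l) \<rho> xs H))"
proof -
  let ?m = "length xs"
  have m: "?m > 0" using assms by simp
  have H: "H \<in> carrier_mat (2 ^ n l) (2 ^ n l)" using assms by (simp add: hermitian_mat_def)
  have \<rho>: "pure_state (n 0) (\<rho> x)" for x using assms by simp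
  note bound = rademacher_model_class_le[OF \<open>l \<ge> 1\<close> \<open>\<gamma> > 0\<close> \<open>1 \<le> p\<close> \<open>0 < q\<close> H \<rho> \<open>xs \<noteq> []\<close>]
  show ?thesis
  proof (intro conjI impI)
    assume "p \<le> 2"
    then have h: "hconj p \<ge> 2" using \<open>1 \<le> p\<close> by (auto simp: hconj_def field_simps)
    define s where "s = sqrt (real_of_ereal (min (hconj p) (ereal (8 * real (n 0)))))"
    \<comment> \<open>The growth constant is \<open>s * sqrt ?m\<close>; division by the sample size
      leaves \<open>s / sqrt ?m\<close>.\<close>
    have "s / sqrt (real ?m) = s * sqrt (real ?m) / real ?m" using m by (simp add: field_simps)
    then show "rademacher xs (model_class p q \<gamma> l n \<rho> H) \<le>
           ereal (\<gamma> * 4 powr (real (n l) * max (einv (hconj p)) (einv q)) *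
                  (\<Prod>i\<in>{1..l-1}. 4 powr (real (n i) * einv (hconj p))) *
                  (s / sqrt (real ?m)) * Kp p (n 0) (n l) \<rho> xs H)"
      using bound[of "s * sqrt (real ?m)"] assms(2) sum_signs_lpnorm_min[OF m finite_pstrs card_pstrs _ h]
      by (simp add: s_def)
  next
    assume p: "2 < p"
    define r where "r = p / (p - 1)"
    have h: "hconj p = ereal r" and r: "1 \<le> r" "r \<le> 2" using p by (auto simp: hconj_def r_def field_simps)
    \<comment> \<open>Duality turns \<open>?m powr (1 / r) / ?m\<close> into the claimed rate
      \<open>1 / ?m powr (1 / p)\<close>.\<close>
    have "1 / r = 1 - 1 / p" using p by (simp add: r_def field_simps)
    then have "sqrt r / real ?m powr (1 / p) = sqrt r * real ?m powr (1 / r) / real ?m"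
      using m by (simp add: powr_diff)
    moreover have "(\<Sum>\<epsilon>\<in>signs ?m. lpnorm (hconj p) (\<lambda>v. \<Sum>i<?m. \<epsilon> i * f i v) (pstrs (n 0)))
        \<le> 2 ^ ?m * (sqrt r * real ?m powr (1 / r) * D)"
      if D: "\<And>i. i < ?m \<Longrightarrow> lpnorm (hconj p) (f i) (pstrs (n 0)) \<le> D" for f :: "nat \<Rightarrow> nat list \<Rightarrow> real" and D
    proof -
      have "D \<ge> 0" using D[OF m] lpnorm_nonneg[OF finite_pstrs pstrs_nonempty] order_trans by blast
      \<comment> \<open>The growth bound for \<open>r \<le> 2\<close> carries the constant 1;
        \<open>r \<ge> 1\<close> allows the factor \<open>sqrt r\<close> of the claim to be
        inserted.\<close>
      then have "1 * (real ?m powr (1 / r) * D) \<le> sqrt r * (real ?m powr (1 / r) * D)"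
        using r by (intro mult_right_mono) auto
      then show ?thesis
        using sum_signs_lpnorm_le_2[OF m r, of f "pstrs (n 0)" D] D
        by (simp add: h mult.assoc) (smt (verit) mult_left_mono zero_le_power)
    qed
    ultimately show "rademacher xs (model_class p q \<gamma> l n \<rho> H) \<le>
           ereal (\<gamma> * 4 powr (real (n l) * max (einv (hconj p)) (einv q)) *
                  (\<Prod>i\<in>{1..l-1}. 4 powr (real (n i) * einv (hconj p))) *
                  (sqrt (real_of_ereal (hconj p)) / real ?m powr (1 / p)) * Kp p (n 0) (n l) \<rho> xs H)"
      using bound[of "sqrt r * real ?m powr (1 / r)"] by (simp add: h)
  qed
qed

end
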